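(* Let $\mathbb{U}$ be a monster model of $\operatorname{Th}(\mathcal{U})$, let $C\subset\mathbb{U}$ be small and $a,b\in\mathbb{U}$. The following are equivalent: (i) $\operatorname{tp}(a/C)$ has a unique extension to $S_1(Cb)$ that does not fork over $C$; (ii) $\operatorname{tp}(a/C)$ has a unique extension to $S_1(Cb)$; (iii) $d_{\max}(a,b/C)=\sup_{c\in C}|d(a,c)-d(b,c)|$.
   Context: $\mathcal{U}$ is the Urysohn sphere (the unique complete separable metric space of diameter 1 that is ultrahomogeneous and universal for separable metric spaces of diameter $\le1$), in continuous logic with only the metric $d$; $\mathbb{U}$ a sufficiently saturated model. Distance arithmetic truncated at $1$; $\sup\emptyset=0$, $\inf\emptyset=1$. $d_{\max}(a,b/C)=\inf_{c\in C}(d(a,c)+d(b,c))$. A formula $\varphi(\bar x,\bar b)$ divides over $C$ if there are $(\bar b^l)_{l<\omega}$ with $\operatorname{tp}(\bar b^l/C)=\operatorname{tp}(\bar b/C)$, $\epsilon>0$, $k>0$ such that every $k$-element subset of $\{\max(\varphi(\bar x,\bar b^l)-\epsilon,0)=0\}$ is unsatisfiable; it forks over $C$ if there are formulas $\psi_1,\dots,\psi_m$ each dividing over $C$ with every realization of $\varphi(\bar x,\bar b)=0$ satisfying $\min_i\psi_i=0$; a type forks over $C$ if it forces $\varphi=0$ for some $\varphi$ forking over $C$. *)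

theory Defs
  imports "HOL-Analysis.Analysis"
begin

unbundle cardinal_syntax

section \<open>The Urysohn sphere\<close>

definition isometric_on :: "'a set \<Rightarrow> ('a \<Rightarrow> 'a \<Rightarrow> real) \<Rightarrow> ('b \<Rightarrow> 'b \<Rightarrow> real) \<Rightarrow> ('a \<Rightarrow> 'b) \<Rightarrow> bool" where
  "isometric_on A d e f \<longleftrightarrow> (\<forall>x\<in>A. \<forall>y\<in>A. e (f x) (f y) = d x y)"

definition ultrahomogeneous :: "'u set \<Rightarrow> ('u \<Rightarrow> 'u \<Rightarrow> real) \<Rightarrow> bool" where
  "ultrahomogeneous U e \<longleftrightarrow>
    (\<forall>A f. finite A \<and> A \<subseteq> U \<and> f ` A \<subseteq> U \<and> isometric_on A e e f \<longrightarrow>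
       (\<exists>g. bij_betw g U U \<and> isometric_on U e e g \<and> (\<forall>x\<in>A. g x = f x)))"

text \<open>
  A separable metric space has at most continuum many points, so letting \<open>X\<close> range over sets of
  reals (with arbitrary metrics \<open>\<rho>\<close>) covers every separable metric space up to isometry.
\<close>

definition universal_separable_le1 :: "'u set \<Rightarrow> ('u \<Rightarrow> 'u \<Rightarrow> real) \<Rightarrow> bool" where
  "universal_separable_le1 U e \<longleftrightarrow>
    (\<forall>(X :: real set) \<rho>.
       Metric_space X \<rho> \<and> separable_space (Metric_space.mtopology X \<rho>) \<and>
       (\<forall>x\<in>X. \<forall>y\<in>X. \<rho> x y \<le> 1) \<longrightarrow>
       (\<exists>f. f ` X \<subseteq> U \<and> isometric_on X \<rho> e f))"

definition urysohn_sphere :: "'u set \<Rightarrow> ('u \<Rightarrow> 'u \<Rightarrow> real) \<Rightarrow> bool" where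
  "urysohn_sphere U e \<longleftrightarrow>
    Metric_space U e \<and> Metric_space.mcomplete U e \<and>
    separable_space (Metric_space.mtopology U e) \<and>
    (\<forall>x\<in>U. \<forall>y\<in>U. e x y \<le> 1) \<and> (SUP (x, y) \<in> U \<times> U. e x y) = 1 \<and>
    ultrahomogeneous U e \<and> universal_separable_le1 U e"

section \<open>Continuous logic in the language of the metric alone\<close>

text \<open>
  \<open>Conn u [\<phi>\<^sub>0, \<dots>, \<phi>\<^sub>n\<^sub>-\<^sub>1]\<close> applies an \<open>n\<close>-ary connective \<open>u\<close>, i.e. a continuous map from
  \<open>[0,1]\<^sup>n\<close> to \<open>[0,1]\<close>. Points of \<open>[0,1]\<^sup>n\<close> are the extensional functions on \<open>{..<n}\<close>, with the
  topology induced by the product topology on \<open>nat \<Rightarrow> real\<close>. Variables are natural numbers.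
\<close>

datatype fm =
    Dist nat nat
  | Conn "(nat \<Rightarrow> real) \<Rightarrow> real" "fm list"
  | SupQ nat fm
  | InfQ nat fm

definition connective :: "nat \<Rightarrow> ((nat \<Rightarrow> real) \<Rightarrow> real) \<Rightarrow> bool" where
  "connective n u \<longleftrightarrow>
    continuous_on ({..<n} \<rightarrow>\<^sub>E {0..1}) u \<and> u ` ({..<n} \<rightarrow>\<^sub>E {0..1}) \<subseteq> {0..1}"

fun wf_fm :: "fm \<Rightarrow> bool" where
  "wf_fm (Dist i j) \<longleftrightarrow> True"
| "wf_fm (Conn u \<phi>s) \<longleftrightarrow> connective (length \<phi>s) u \<and> (\<forall>\<phi>\<in>set \<phi>s. wf_fm \<phi>)"
| "wf_fm (SupQ i \<phi>) \<longleftrightarrow> wf_fm \<phi>"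
| "wf_fm (InfQ i \<phi>) \<longleftrightarrow> wf_fm \<phi>"

fun fv :: "fm \<Rightarrow> nat set" where
  "fv (Dist i j) = {i, j}"
| "fv (Conn u \<phi>s) = (\<Union>\<phi>\<in>set \<phi>s. fv \<phi>)"
| "fv (SupQ i \<phi>) = fv \<phi> - {i}"
| "fv (InfQ i \<phi>) = fv \<phi> - {i}"

fun val :: "'a set \<Rightarrow> ('a \<Rightarrow> 'a \<Rightarrow> real) \<Rightarrow> fm \<Rightarrow> (nat \<Rightarrow> 'a) \<Rightarrow> real" where
  "val M d (Dist i j) s = d (s i) (s j)"
| "val M d (Conn u \<phi>s) s = u (\<lambda>i\<in>{..<length \<phi>s}. map (\<lambda>\<phi>. val M d \<phi> s) \<phi>s ! i)"
| "val M d (SupQ i \<phi>) s = (SUP x\<in>M. val M d \<phi> (s(i := x)))"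
| "val M d (InfQ i \<phi>) s = (INF x\<in>M. val M d \<phi> (s(i := x)))"

definition formula :: "nat \<Rightarrow> fm \<Rightarrow> bool" where
  "formula n \<phi> \<longleftrightarrow> wf_fm \<phi> \<and> fv \<phi> \<subseteq> {..<n}"

text \<open>Only used for lists at least as long as the number of free variables of the formula.\<close>

definition ev :: "'a set \<Rightarrow> ('a \<Rightarrow> 'a \<Rightarrow> real) \<Rightarrow> fm \<Rightarrow> 'a list \<Rightarrow> real" where
  "ev M d \<phi> xs = val M d \<phi> (\<lambda>i. xs ! i)"

definition Th :: "'u set \<Rightarrow> ('u \<Rightarrow> 'u \<Rightarrow> real) \<Rightarrow> fm set" where
  "Th U e = {\<sigma>. formula 0 \<sigma> \<and> ev U e \<sigma> [] = 0}"

definition model :: "'a set \<Rightarrow> ('a \<Rightarrow> 'a \<Rightarrow> real) \<Rightarrow> fm set \<Rightarrow> bool" where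
  "model M d T \<longleftrightarrow>
    M \<noteq> {} \<and> Metric_space M d \<and> Metric_space.mcomplete M d \<and> (\<forall>x\<in>M. \<forall>y\<in>M. d x y \<le> 1) \<and>
    (\<forall>\<sigma>\<in>T. ev M d \<sigma> [] = 0)"

section \<open>Types and saturation\<close>

definition tuples :: "'a set \<Rightarrow> nat \<Rightarrow> 'a list set" where
  "tuples M n = {xs. length xs = n \<and> set xs \<subseteq> M}"

text \<open>
  The pair \<open>(\<phi>, bs)\<close> stands for the formula \<open>\<phi>(x\<^sub>0, \<dots>, x\<^sub>n\<^sub>-\<^sub>1, bs)\<close> with parameters \<open>bs\<close> (variables
  from \<open>n\<close> on are replaced by \<open>bs\<close>); as an element of a type it stands for the condition
  \<open>\<phi>(x, bs) = 0\<close>.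
\<close>

definition formulas_over :: "nat \<Rightarrow> 'a set \<Rightarrow> (fm \<times> 'a list) set" where
  "formulas_over n A = {(\<phi>, bs). set bs \<subseteq> A \<and> formula (n + length bs) \<phi>}"

definition realizes ::
    "'a set \<Rightarrow> ('a \<Rightarrow> 'a \<Rightarrow> real) \<Rightarrow> 'a list \<Rightarrow> (fm \<times> 'a list) set \<Rightarrow> bool" where
  "realizes M d xs p \<longleftrightarrow> (\<forall>(\<phi>, bs)\<in>p. ev M d \<phi> (xs @ bs) = 0)"

definition tp ::
    "'a set \<Rightarrow> ('a \<Rightarrow> 'a \<Rightarrow> real) \<Rightarrow> 'a list \<Rightarrow> 'a set \<Rightarrow> (fm \<times> 'a list) set" where
  "tp M d xs A = {(\<phi>, bs) \<in> formulas_over (length xs) A. ev M d \<phi> (xs @ bs) = 0}"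

text \<open>
  By compactness, a set of conditions is consistent with the elementary diagram of \<open>M\<close> iff each of
  its finite subsets is approximately satisfiable in \<open>M\<close>.
\<close>

definition consistent ::
    "'a set \<Rightarrow> ('a \<Rightarrow> 'a \<Rightarrow> real) \<Rightarrow> nat \<Rightarrow> (fm \<times> 'a list) set \<Rightarrow> bool" where
  "consistent M d n p \<longleftrightarrow>
    (\<forall>F \<epsilon>. finite F \<and> F \<subseteq> p \<and> \<epsilon> > 0 \<longrightarrow>
       (\<exists>xs\<in>tuples M n. \<forall>(\<phi>, bs)\<in>F. ev M d \<phi> (xs @ bs) \<le> \<epsilon>))"

text \<open>\<open>complete_types M d n A\<close> is \<open>S\<^sub>n(A)\<close>.\<close>

definition complete_types ::
    "'a set \<Rightarrow> ('a \<Rightarrow> 'a \<Rightarrow> real) \<Rightarrow> nat \<Rightarrow> 'a set \<Rightarrow> (fm \<times> 'a list) set set" where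
  "complete_types M d n A =
    {p. p \<subseteq> formulas_over n A \<and> consistent M d n p \<and>
        (\<forall>q. q \<subseteq> formulas_over n A \<and> consistent M d n q \<and> p \<subseteq> q \<longrightarrow> q = p)}"

definition saturated :: "'k rel \<Rightarrow> 'a set \<Rightarrow> ('a \<Rightarrow> 'a \<Rightarrow> real) \<Rightarrow> bool" where
  "saturated \<kappa> M d \<longleftrightarrow>
    (\<forall>A n p. A \<subseteq> M \<and> |A| <o \<kappa> \<and> p \<subseteq> formulas_over n A \<and>
       (\<forall>F. finite F \<and> F \<subseteq> p \<longrightarrow> (\<exists>xs\<in>tuples M n. realizes M d xs F)) \<longrightarrow>
       (\<exists>xs\<in>tuples M n. realizes M d xs p))"

text \<open>A set is small when its cardinality is below the degree of saturation \<open>\<kappa>\<close>.\<close>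

definition monster_model :: "'k rel \<Rightarrow> 'a set \<Rightarrow> ('a \<Rightarrow> 'a \<Rightarrow> real) \<Rightarrow> fm set \<Rightarrow> bool" where
  "monster_model \<kappa> M d T \<longleftrightarrow>
    Card_order \<kappa> \<and> natLeq <o \<kappa> \<and> model M d T \<and> saturated \<kappa> M d"

section \<open>Dividing and forking\<close>

text \<open>
  Subsets of the sequence of conditions are taken with respect to the index \<open>l\<close>, so that
  repetitions among the \<open>B l\<close> count.
\<close>

definition divides ::
    "'a set \<Rightarrow> ('a \<Rightarrow> 'a \<Rightarrow> real) \<Rightarrow> 'a set \<Rightarrow> nat \<Rightarrow> fm \<Rightarrow> 'a list \<Rightarrow> bool" where
  "divides M d C n \<phi> bs \<longleftrightarrow>
    (\<exists>(B :: nat \<Rightarrow> 'a list) (\<epsilon> :: real) (k :: nat).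
       (\<forall>l. B l \<in> tuples M (length bs) \<and> tp M d (B l) C = tp M d bs C) \<and> \<epsilon> > 0 \<and> k > 0 \<and>
       (\<forall>I. finite I \<and> card I = k \<longrightarrow>
          \<not> (\<exists>xs\<in>tuples M n. \<forall>l\<in>I. max (ev M d \<phi> (xs @ B l) - \<epsilon>) 0 = 0)))"

definition forks ::
    "'a set \<Rightarrow> ('a \<Rightarrow> 'a \<Rightarrow> real) \<Rightarrow> 'a set \<Rightarrow> nat \<Rightarrow> fm \<Rightarrow> 'a list \<Rightarrow> bool" where
  "forks M d C n \<phi> bs \<longleftrightarrow>
    (\<exists>\<Psi>. finite \<Psi> \<and> \<Psi> \<noteq> {} \<and> \<Psi> \<subseteq> formulas_over n M \<and>
       (\<forall>(\<psi>, cs)\<in>\<Psi>. divides M d C n \<psi> cs) \<and>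
       (\<forall>xs\<in>tuples M n. ev M d \<phi> (xs @ bs) = 0 \<longrightarrow>
          Min ((\<lambda>(\<psi>, cs). ev M d \<psi> (xs @ cs)) ` \<Psi>) = 0))"

definition type_forks ::
    "'a set \<Rightarrow> ('a \<Rightarrow> 'a \<Rightarrow> real) \<Rightarrow> 'a set \<Rightarrow> nat \<Rightarrow> (fm \<times> 'a list) set \<Rightarrow> bool" where
  "type_forks M d C n p \<longleftrightarrow>
    (\<exists>(\<phi>, bs)\<in>formulas_over n M. forks M d C n \<phi> bs \<and>
       (\<forall>xs\<in>tuples M n. realizes M d xs p \<longrightarrow> ev M d \<phi> (xs @ bs) = 0))"

section \<open>Bounds on the distance over a set\<close>

definition inf01 :: "real set \<Rightarrow> real" where
  "inf01 X = (if X = {} then 1 else Inf X)"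

definition sup01 :: "real set \<Rightarrow> real" where
  "sup01 X = (if X = {} then 0 else Sup X)"

definition d_max :: "('a \<Rightarrow> 'a \<Rightarrow> real) \<Rightarrow> 'a \<Rightarrow> 'a \<Rightarrow> 'a set \<Rightarrow> real" where
  "d_max d a b C = inf01 ((\<lambda>c. min (d a c + d b c) 1) ` C)"

end

theory Submission
  imports Defs
begin

text \<open>
  Saturation turns the finite extension property of the Urysohn sphere into the following: every
  Katetov function on a small subset of \<open>M\<close> is the distance function of a point of \<open>M\<close>. Hence \<open>M\<close>
  has quantifier elimination, a type over \<open>Cb\<close> extending that of \<open>a\<close> over \<open>C\<close> is determined by
  the distance \<open>r\<close> of its realizations to \<open>b\<close>, and the possible values of \<open>r\<close> are those of the
  interval from \<open>sup\<^sub>c \<bar>d(a,c) - d(b,c)\<bar>\<close> to \<open>d_max(a,b/C)\<close>. This gives the equivalence of (ii) and (iii).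

  If moreover \<open>2r \<ge> d_max(b,b/C)\<close>, then the type with distance \<open>r\<close> does not fork over \<open>C\<close>:
  the function \<open>y \<mapsto> min(d_max(a,y/C), r + sup\<^sub>c \<bar>d(b,c) - d(y,c)\<bar>)\<close> on \<open>M\<close> is Katetov and depends
  only on the type of \<open>y\<close> over \<open>C\<close>, so one point realizes it over all members of a sequence of
  conjugates at once, and no formula satisfied by such a point divides. The upper end of the
  interval always satisfies the condition on \<open>r\<close>, and if the interval is nondegenerate so does
  some smaller value; thus there are at least two nonforking extensions in that case, and at
  least one in any case.
\<close>

section \<open>Bounded metric spaces and Katetov functions\<close>

locale bounded_metric = Metric_space M d for M :: "'a set" and d +
  assumes nonempty: "M \<noteq> {}"
    and dist_le_1: "\<And>x y. x \<in> M \<Longrightarrow> y \<in> M \<Longrightarrow> d x y \<le> 1"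

text \<open>These are the conditions for adding one point at distance \<open>f x\<close> from each
  \<open>x\<close> in \<open>A\<close> while keeping the diameter at most 1. Zeros of
  \<open>f\<close> are allowed: the added point then coincides with a point of
  \<open>A\<close>.\<close>

definition katetov :: "('a \<Rightarrow> 'a \<Rightarrow> real) \<Rightarrow> 'a set \<Rightarrow> ('a \<Rightarrow> real) \<Rightarrow> bool" where
  "katetov d A f \<longleftrightarrow>
    (\<forall>x\<in>A. 0 \<le> f x \<and> f x \<le> 1 \<and> (\<forall>y\<in>A. f x \<le> f y + d x y \<and> d x y \<le> f x + f y))"

lemma katetovD:
  assumes "katetov d A f" "x \<in> A"
  shows "0 \<le> f x" "f x \<le> 1" "y \<in> A \<Longrightarrow> f x \<le> f y + d x y" "y \<in> A \<Longrightarrow> d x y \<le> f x + f y"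
  using assms by (auto simp: katetov_def)

lemma katetov_subset: "katetov d A f \<Longrightarrow> B \<subseteq> A \<Longrightarrow> katetov d B f"
  unfolding katetov_def by blast

lemma katetov_dist:
  assumes "bounded_metric M d" "A \<subseteq> M" "x \<in> M"
  shows "katetov d A (d x)"
proof -
  interpret bounded_metric M d by fact
  show ?thesis
    unfolding katetov_def
    using assms(2,3) dist_le_1 triangle commute by (metis nonneg subsetD)
qed

section \<open>One-point extensions in the Urysohn sphere\<close>

text \<open>If \<open>f\<close> vanishes at a point of \<open>A\<close>, that point serves as
  \<open>z\<close>. Otherwise \<open>A\<close> together with a new point is a finite metric space;
  universality embeds it into \<open>U\<close>, and ultrahomogeneity moves the copy of
  \<open>A\<close> back onto \<open>A\<close>, carrying the image of the new point to
  \<open>z\<close>.\<close>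

lemma urysohn_one_point_extension:
  assumes U: "urysohn_sphere U e" and A: "finite A" "A \<subseteq> U" and f: "katetov e A f"
  obtains z where "z \<in> U" "\<And>x. x \<in> A \<Longrightarrow> e z x = f x"
proof (cases "\<exists>x\<in>A. f x = 0")
  interpret Metric_space U e using U by (simp add: urysohn_sphere_def)
  case True
  then obtain x where x: "x \<in> A" "f x = 0" by blast
  have "e x y = f y" if "y \<in> A" for y
    using katetovD(3)[OF f that x(1)] katetovD(4)[OF f x(1) that] x commute[of x y]
    by simp
  with x A that show thesis by blast
next
  interpret Metric_space U e using U by (simp add: urysohn_sphere_def)
  case False
  \<comment> \<open>\<open>None\<close> is the new point, and \<open>D\<close> is the metric
    extended to it by \<open>f\<close>.\<close>
  define S where "S = insert None (Some ` A)"
  define D where "D p q = (case (p, q) of (None, None) \<Rightarrow> 0 | (None, Some x) \<Rightarrow> f x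
      | (Some x, None) \<Rightarrow> f x | (Some x, Some y) \<Rightarrow> e x y)" for p q
  have D_simps: "D None None = 0" "D None (Some x) = f x" "D (Some x) None = f x"
    "D (Some x) (Some y) = e x y" for x y by (simp_all add: D_def)
  have pos: "f x > 0" if "x \<in> A" for x
    using False that katetovD(1)[OF f that] by (metis order_le_less)
  have "finite S" using A by (simp add: S_def)
  \<comment> \<open>Universality is formulated for metrics on sets of reals, so the finite space
    \<open>S\<close> is copied onto a set \<open>X\<close> of reals.\<close>
  then obtain h :: "'a option \<Rightarrow> nat" where h: "inj_on h S"
    using finite_imp_inj_to_nat_seg by metis
  define h' where "h' p = real (h p)" for p
  have h': "inj_on h' S" using h by (auto simp: inj_on_def h'_def)
  define k where "k = inv_into S h'"
  have k: "k (h' p) = p" if "p \<in> S" for p using h' that by (simp add: k_def)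
  define X where "X = h' ` S"
  define \<rho> where "\<rho> x y = D (k x) (k y)" for x y
  have kX: "k x \<in> S" "h' (k x) = x" if "x \<in> X" for x
    using that k by (auto simp: X_def)
  have S_cases: "p = None \<or> (\<exists>x. p = Some x \<and> x \<in> A \<and> x \<in> U)" if "p \<in> S" for p
    using that A by (auto simp: S_def)
  have D_nonneg: "0 \<le> D p q" if "p \<in> S" "q \<in> S" for p q
    using that katetovD(1)[OF f] A
    by (auto simp: S_def D_simps)
  have D_sym: "D p q = D q p" for p q
    by (cases p; cases q) (auto simp: D_simps commute)
  have D_zero: "D p q = 0 \<longleftrightarrow> p = q" if "p \<in> S" "q \<in> S" for p q
    using S_cases[OF that(1)] S_cases[OF that(2)] pos
    by (elim disjE exE conjE) (fastforce simp: D_simps)+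
  have D_triangle: "D p r \<le> D p q + D q r" if "p \<in> S" "q \<in> S" "r \<in> S" for p q r
  proof -
    have "f x \<le> e x y + f y" "f x \<le> f y + e y x" "e x y \<le> f x + f y" "0 \<le> f x"
      if "x \<in> A" "y \<in> A" for x y
      using katetovD(1)[OF f that(1)] katetovD(3,4)[OF f that] commute[of x y] by auto
    then show ?thesis
      using S_cases[OF that(1)] S_cases[OF that(2)] S_cases[OF that(3)] triangle
      by (elim disjE exE conjE) (simp_all add: D_simps)
  qed
  have e_le1: "e x y \<le> 1" if "x \<in> U" "y \<in> U" for x y
    using U that unfolding urysohn_sphere_def by blast
  have D_le1: "D p q \<le> 1" if "p \<in> S" "q \<in> S" for p q
    using S_cases[OF that(1)] S_cases[OF that(2)] katetovD(2)[OF f] e_le1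
    by (elim disjE exE conjE) (simp_all add: D_simps)
  \<comment> \<open>\<open>Metric_space\<close> demands nonnegativity and symmetry also off the
    carrier, where \<rho> is uncontrolled; the value is reset to 0 there.\<close>
  have "\<exists>\<rho>'. Metric_space X \<rho>' \<and> (\<forall>x\<in>X. \<forall>y\<in>X. \<rho>' x y = \<rho> x y)"
  proof -
    let ?r = "\<lambda>x y. if x \<in> X \<and> y \<in> X then \<rho> x y else 0"
    have "Metric_space X ?r"
    proof
      show "0 \<le> ?r x y" for x y by (simp add: \<rho>_def D_nonneg kX)
      show "?r x y = ?r y x" for x y by (simp add: \<rho>_def D_sym)
      show "?r x y = 0 \<longleftrightarrow> x = y" if "x \<in> X" "y \<in> X" for x y
        using that kX by (simp add: \<rho>_def D_zero) metis
      show "?r x z \<le> ?r x y + ?r y z" if "x \<in> X" "y \<in> X" "z \<in> X" for x y z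
        using that by (simp add: \<rho>_def D_triangle kX)
    qed
    then show ?thesis by (intro exI[of _ ?r]) auto
  qed
  then obtain \<rho>' where \<rho>': "Metric_space X \<rho>'"
    and \<rho>'_eq: "\<And>x y. x \<in> X \<Longrightarrow> y \<in> X \<Longrightarrow> \<rho>' x y = \<rho> x y" by blast
  interpret X: Metric_space X \<rho>' by fact
  have "finite X" using \<open>finite S\<close> by (simp add: X_def)
  then have "separable_space X.mtopology"
    unfolding separable_space_def
    using closure_of_topspace[of X.mtopology] by (intro exI[of _ X]) (simp add: countable_finite)
  moreover have "\<forall>x\<in>X. \<forall>y\<in>X. \<rho>' x y \<le> 1"
    by (simp add: \<rho>'_eq \<rho>_def D_le1 kX)
  ultimately have "\<exists>F. F ` X \<subseteq> U \<and> isometric_on X \<rho>' e F"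
    using U X.Metric_space_axioms unfolding urysohn_sphere_def universal_separable_le1_def by simp
  then obtain F where F: "F ` X \<subseteq> U" "isometric_on X \<rho>' e F" by blast
  define G where "G p = F (h' p)" for p
  have "h' p \<in> X" if "p \<in> S" for p using that by (simp add: X_def)
  then have G_in: "G p \<in> U" and G_dist: "e (G p) (G q) = D p q" if "p \<in> S" "q \<in> S" for p q
    using F that by (simp_all add: G_def isometric_on_def image_subset_iff \<rho>'_eq \<rho>_def k)
  have G: "G None \<in> U" "\<And>x. x \<in> A \<Longrightarrow> G (Some x) \<in> U"
    "\<And>x y. x \<in> A \<Longrightarrow> y \<in> A \<Longrightarrow> e (G (Some x)) (G (Some y)) = e x y"
    "\<And>x. x \<in> A \<Longrightarrow> e (G None) (G (Some x)) = f x"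
    using G_in[of _ None] G_dist by (simp_all add: S_def D_simps)
  \<comment> \<open>\<open>H\<close> sends the embedded copy of \<open>A\<close> back to
    \<open>A\<close>; its extension \<open>g\<close> to all of \<open>U\<close> is then applied to
    \<open>G None\<close>.\<close>
  define H where "H = inv_into A (\<lambda>x. G (Some x))"
  have "inj_on (\<lambda>x. G (Some x)) A"
  proof (rule inj_onI)
    fix x y assume xy: "x \<in> A" "y \<in> A" "G (Some x) = G (Some y)"
    then have "e x y = e (G (Some y)) (G (Some y))" using G(3)[of x y] by simp
    then show "x = y" using G(2) xy A by (simp add: subset_iff)
  qed
  then have H: "H (G (Some x)) = x" if "x \<in> A" for x
    unfolding H_def using that by (rule inv_into_f_f)
  let ?A = "(\<lambda>x. G (Some x)) ` A"
  have *: "finite ?A \<and> ?A \<subseteq> U \<and> H ` ?A \<subseteq> U \<and> isometric_on ?A e e H"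
    using A G(2,3) by (auto simp: H isometric_on_def)
  have "ultrahomogeneous U e" using U by (simp add: urysohn_sphere_def)
  note this[unfolded ultrahomogeneous_def, THEN spec[of _ ?A], THEN spec[of _ H], THEN mp, OF *]
  then have "\<exists>g. bij_betw g U U \<and> isometric_on U e e g \<and> (\<forall>x\<in>?A. g x = H x)"
    by assumption
  then obtain g where g: "bij_betw g U U" "isometric_on U e e g" "\<forall>x\<in>?A. g x = H x"
    by blast
  show thesis
  proof (rule that[of "g (G None)"])
    show "g (G None) \<in> U" using g(1) G(1) bij_betwE by blast
    show "e (g (G None)) x = f x" if "x \<in> A" for x
    proof -
      have "x = g (G (Some x))" using g(3) H that by auto
      then have "e (g (G None)) x = e (G None) (G (Some x))"
        using g(2) G(1) G(2)[OF that] by (metis isometric_on_def)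
      also have "\<dots> = f x" using G(4)[OF that] .
      finally show ?thesis .
    qed
  qed
qed

section \<open>Formulas built from unary and binary connectives\<close>

definition zero_fm :: fm where
  "zero_fm = Conn (\<lambda>v. 0) []"

definition un_fm :: "(real \<Rightarrow> real) \<Rightarrow> fm \<Rightarrow> fm" where
  "un_fm g \<phi> = Conn (\<lambda>v. g (v 0)) [\<phi>]"

definition bin_fm :: "(real \<Rightarrow> real \<Rightarrow> real) \<Rightarrow> fm \<Rightarrow> fm \<Rightarrow> fm" where
  "bin_fm g \<phi> \<psi> = Conn (\<lambda>v. g (v 0) (v 1)) [\<phi>, \<psi>]"

definition max_fm :: "fm list \<Rightarrow> fm" where
  "max_fm \<phi>s = foldr (bin_fm max) \<phi>s zero_fm"

text \<open>Types contain only conditions of the form "value 0". This formula and the next two put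
  the conditions \<phi> = r, \<phi> \<le> \<psi> and \<phi> \<le> r into that form.\<close>

definition near_fm :: "real \<Rightarrow> fm \<Rightarrow> fm" where
  "near_fm r \<phi> = un_fm (\<lambda>t. \<bar>t - r\<bar>) \<phi>"

definition monus_fm :: "fm \<Rightarrow> fm \<Rightarrow> fm" where
  "monus_fm = bin_fm (\<lambda>s t. max (s - t) 0)"

definition shrink_fm :: "real \<Rightarrow> fm \<Rightarrow> fm" where
  "shrink_fm r \<phi> = un_fm (\<lambda>t. max (t - r) 0) \<phi>"

lemma val_simps [simp]:
  "val M d zero_fm s = 0"
  "val M d (un_fm g \<phi>) s = g (val M d \<phi> s)"
  "val M d (bin_fm h \<phi> \<psi>) s = h (val M d \<phi> s) (val M d \<psi> s)"
  "val M d (near_fm r \<phi>) s = \<bar>val M d \<phi> s - r\<bar>"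
  "val M d (monus_fm \<phi> \<psi>) s = max (val M d \<phi> s - val M d \<psi> s) 0"
  "val M d (shrink_fm r \<phi>) s = max (val M d \<phi> s - r) 0"
  by (simp_all add: zero_fm_def un_fm_def bin_fm_def near_fm_def monus_fm_def shrink_fm_def)

lemma fv_simps [simp]:
  "fv zero_fm = {}"
  "fv (un_fm g \<phi>) = fv \<phi>"
  "fv (bin_fm h \<phi> \<psi>) = fv \<phi> \<union> fv \<psi>"
  "fv (near_fm r \<phi>) = fv \<phi>"
  "fv (monus_fm \<phi> \<psi>) = fv \<phi> \<union> fv \<psi>"
  "fv (shrink_fm r \<phi>) = fv \<phi>"
  by (simp_all add: zero_fm_def un_fm_def bin_fm_def near_fm_def monus_fm_def shrink_fm_def)

lemma fv_max_fm [simp]: "fv (max_fm \<phi>s) = (\<Union>\<phi>\<in>set \<phi>s. fv \<phi>)"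
  by (induction \<phi>s) (simp_all add: max_fm_def)

text \<open>The fold ends in \<open>zero_fm\<close>, which accounts for the clause 0 \<le>
  t.\<close>

lemma val_max_fm_le_iff:
  "val M d (max_fm \<phi>s) s \<le> t \<longleftrightarrow> 0 \<le> t \<and> (\<forall>\<phi>\<in>set \<phi>s. val M d \<phi> s \<le> t)"
  by (induction \<phi>s) (auto simp: max_fm_def)

lemma continuous_on_coordinate: "continuous_on S (\<lambda>v. v i :: real)"
  by (rule continuous_on_product_then_coordinatewise) (rule continuous_on_id)

lemma wf_zero_fm [simp]: "wf_fm zero_fm"
  by (simp add: zero_fm_def connective_def)

lemma wf_un_fm:
  assumes "continuous_on {0..1} g" "g ` {0..1} \<subseteq> {0..1}" "wf_fm \<phi>"
  shows "wf_fm (un_fm g \<phi>)"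
proof -
  have "continuous_on ({..<1::nat} \<rightarrow>\<^sub>E {0..1}) (\<lambda>v. g (v 0))"
    by (rule continuous_on_compose2[OF assms(1) continuous_on_coordinate]) (auto simp: PiE_def Pi_def)
  moreover have "(\<lambda>v. g (v 0)) ` ({..<1::nat} \<rightarrow>\<^sub>E {0..1}) \<subseteq> {0..1}"
    using assms(2) by (auto simp: PiE_def Pi_def)
  ultimately show ?thesis
    using assms(3) by (simp add: un_fm_def connective_def)
qed

lemma wf_bin_fm:
  assumes "continuous_on ({0..1} \<times> {0..1}) (\<lambda>(s, t). h s t)"
    "\<And>s t. s \<in> {0..1} \<Longrightarrow> t \<in> {0..1} \<Longrightarrow> h s t \<in> {0..1}" "wf_fm \<phi>" "wf_fm \<psi>"
  shows "wf_fm (bin_fm h \<phi> \<psi>)"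
proof -
  have "continuous_on ({..<2::nat} \<rightarrow>\<^sub>E {0..1}) (\<lambda>v. (\<lambda>(s, t). h s t) (v 0, v 1))"
    by (rule continuous_on_compose2[OF assms(1)])
      (auto simp: PiE_def Pi_def intro!: continuous_on_Pair continuous_on_coordinate)
  moreover have "(\<lambda>v. h (v 0) (v 1)) ` ({..<2::nat} \<rightarrow>\<^sub>E {0..1}) \<subseteq> {0..1}"
    using assms(2) by (auto simp: PiE_def Pi_def simp del: atLeastAtMost_iff)
  ultimately show ?thesis
    using assms(3,4) by (simp add: bin_fm_def connective_def numeral_2_eq_2)
qed

lemma wf_near_fm: "r \<in> {0..1} \<Longrightarrow> wf_fm \<phi> \<Longrightarrow> wf_fm (near_fm r \<phi>)"
  unfolding near_fm_def by (rule wf_un_fm) (auto intro!: continuous_intros)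

lemma wf_shrink_fm: "r \<ge> 0 \<Longrightarrow> wf_fm \<phi> \<Longrightarrow> wf_fm (shrink_fm r \<phi>)"
  unfolding shrink_fm_def by (rule wf_un_fm) (auto intro!: continuous_intros)

lemma wf_monus_fm: "wf_fm \<phi> \<Longrightarrow> wf_fm \<psi> \<Longrightarrow> wf_fm (monus_fm \<phi> \<psi>)"
  unfolding monus_fm_def
  by (rule wf_bin_fm) (auto intro!: continuous_intros simp: case_prod_beta)

lemma wf_max_fm: "(\<And>\<phi>. \<phi> \<in> set \<phi>s \<Longrightarrow> wf_fm \<phi>) \<Longrightarrow> wf_fm (max_fm \<phi>s)"
proof (induction \<phi>s)
  case (Cons \<phi> \<phi>s)
  have "wf_fm (bin_fm max \<phi> (max_fm \<phi>s))"
    using Cons by (intro wf_bin_fm) (auto intro!: continuous_intros simp: case_prod_beta)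
  then show ?case by (simp add: max_fm_def)
qed (simp add: max_fm_def)

section \<open>Basic properties of the evaluation of formulas\<close>

lemma finite_fv: "finite (fv \<phi>)"
  by (induction \<phi>) auto

lemma val_cong: "(\<And>i. i \<in> fv \<phi> \<Longrightarrow> s i = t i) \<Longrightarrow> val M d \<phi> s = val M d \<phi> t"
proof (induction \<phi> arbitrary: s t)
  case (Conn u \<phi>s)
  have "map (\<lambda>\<phi>. val M d \<phi> s) \<phi>s = map (\<lambda>\<phi>. val M d \<phi> t) \<phi>s"
    by (intro map_cong refl Conn.IH Conn.prems) auto
  then show ?case by (simp only: val.simps)
next
  case (SupQ i \<phi>)
  have "val M d \<phi> (s(i := x)) = val M d \<phi> (t(i := x))" for x
    by (rule SupQ.IH) (simp add: SupQ.prems)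
  then show ?case by (simp only: val.simps)
next
  case (InfQ i \<phi>)
  have "val M d \<phi> (s(i := x)) = val M d \<phi> (t(i := x))" for x
    by (rule InfQ.IH) (simp add: InfQ.prems)
  then show ?case by (simp only: val.simps)
qed simp

context bounded_metric
begin

text \<open>Quantifiers are evaluated by \<open>Sup\<close> and \<open>Inf\<close> of reals, which
  behave well only on nonempty bounded sets; the induction supplies the bounds and
  \<open>nonempty\<close> the rest.\<close>

lemma val_in_01: "wf_fm \<phi> \<Longrightarrow> s ` fv \<phi> \<subseteq> M \<Longrightarrow> val M d \<phi> s \<in> {0..1}"
proof (induction \<phi> arbitrary: s)
  case (Dist i j)
  then show ?case using dist_le_1 by simp
next
  case (Conn u \<phi>s)
  have "val M d (\<phi>s ! i) s \<in> {0..1}" if "i < length \<phi>s" for i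
    using that Conn.prems by (intro Conn.IH) (auto simp: image_subset_iff)
  then have "(\<lambda>i\<in>{..<length \<phi>s}. map (\<lambda>\<phi>. val M d \<phi> s) \<phi>s ! i) \<in> {..<length \<phi>s} \<rightarrow>\<^sub>E {0..1}"
    by (intro restrict_PiE_iff[THEN iffD2] ballI) simp
  then show ?case using Conn.prems by (auto simp: connective_def image_subset_iff)
next
  case (SupQ i \<phi>)
  have *: "val M d \<phi> (s(i := x)) \<in> {0..1}" if "x \<in> M" for x
    using SupQ.prems that by (intro SupQ.IH) auto
  then have bdd: "bdd_above ((\<lambda>x. val M d \<phi> (s(i := x))) ` M)" by (auto intro!: bdd_aboveI[of _ 1])
  obtain x where "x \<in> M" using nonempty by blast
  then have "0 \<le> (SUP x\<in>M. val M d \<phi> (s(i := x)))"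
    using *[of x] by (intro cSUP_upper2[OF bdd]) auto
  moreover have "(SUP x\<in>M. val M d \<phi> (s(i := x))) \<le> 1"
    using * nonempty by (intro cSUP_least) auto
  ultimately show ?case by simp
next
  case (InfQ i \<phi>)
  have *: "val M d \<phi> (s(i := x)) \<in> {0..1}" if "x \<in> M" for x
    using InfQ.prems that by (intro InfQ.IH) auto
  then have bdd: "bdd_below ((\<lambda>x. val M d \<phi> (s(i := x))) ` M)" by (auto intro!: bdd_belowI[of _ 0])
  obtain x where "x \<in> M" using nonempty by blast
  then have "(INF x\<in>M. val M d \<phi> (s(i := x))) \<le> 1"
    using *[of x] by (intro cINF_lower2[OF bdd]) auto
  moreover have "0 \<le> (INF x\<in>M. val M d \<phi> (s(i := x)))"
    using * nonempty by (intro cINF_greatest) auto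
  ultimately show ?case by simp
qed

section \<open>Universal statements expressed by sentences\<close>

lemma val_SupQ_eq_0_iff:
  assumes "wf_fm \<phi>" "s ` (fv \<phi> - {i}) \<subseteq> M"
  shows "val M d (SupQ i \<phi>) s = 0 \<longleftrightarrow> (\<forall>x\<in>M. val M d \<phi> (s(i := x)) = 0)"
proof
  have *: "val M d \<phi> (s(i := x)) \<in> {0..1}" if "x \<in> M" for x
    using assms that by (intro val_in_01) auto
  assume L: "val M d (SupQ i \<phi>) s = 0"
  show "\<forall>x\<in>M. val M d \<phi> (s(i := x)) = 0"
  proof
    fix x assume "x \<in> M"
    then have "val M d \<phi> (s(i := x)) \<le> (SUP x\<in>M. val M d \<phi> (s(i := x)))"
      using * by (intro cSUP_upper) (auto intro!: bdd_aboveI[of _ 1])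
    then show "val M d \<phi> (s(i := x)) = 0" using L *[OF \<open>x \<in> M\<close>] by simp
  qed
qed (use nonempty in simp)

text \<open>A theory consists of sentences of value 0. A formula that vanishes at all assignments
  becomes such a sentence after prefixing supremum quantifiers; this notion carries the fact from
  \<open>U\<close> to \<open>M\<close>, one quantifier at a time.\<close>

definition universally_zero :: "fm \<Rightarrow> bool" where
  "universally_zero \<phi> \<longleftrightarrow> (\<forall>s. s ` fv \<phi> \<subseteq> M \<longrightarrow> val M d \<phi> s = 0)"

lemma universally_zero_SupQ:
  assumes "wf_fm \<phi>"
  shows "universally_zero (SupQ i \<phi>) \<longleftrightarrow> universally_zero \<phi>"
proof
  assume L: "universally_zero (SupQ i \<phi>)"
  show "universally_zero \<phi>"
    unfolding universally_zero_def
  proof (intro allI impI)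
    fix s assume s: "s ` fv \<phi> \<subseteq> M"
    obtain y where "y \<in> M" using nonempty by blast
    \<comment> \<open>If \<open>i\<close> is not free in \<phi>, then \<open>s i\<close> may lie
      outside \<open>M\<close>; any point of \<open>M\<close> can replace it without changing the
      value.\<close>
    define x where "x = (if i \<in> fv \<phi> then s i else y)"
    have "x \<in> M" using s \<open>y \<in> M\<close> by (auto simp: x_def)
    have s': "s ` (fv \<phi> - {i}) \<subseteq> M" using s by blast
    then have "val M d (SupQ i \<phi>) s = 0" using L by (simp add: universally_zero_def)
    then have "val M d \<phi> (s(i := x)) = 0"
      using val_SupQ_eq_0_iff[OF assms s'] \<open>x \<in> M\<close> by blast
    moreover have "val M d \<phi> (s(i := x)) = val M d \<phi> s"
      by (rule val_cong) (auto simp: x_def)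
    ultimately show "val M d \<phi> s = 0" by simp
  qed
next
  assume R: "universally_zero \<phi>"
  show "universally_zero (SupQ i \<phi>)"
    unfolding universally_zero_def
  proof (intro allI impI)
    fix s assume "s ` fv (SupQ i \<phi>) \<subseteq> M"
    then have s: "s ` (fv \<phi> - {i}) \<subseteq> M" by simp
    have "val M d \<phi> (s(i := x)) = 0" if "x \<in> M" for x
      using R s that unfolding universally_zero_def by (auto simp: image_subset_iff)
    then show "val M d (SupQ i \<phi>) s = 0" using val_SupQ_eq_0_iff[OF assms s] by blast
  qed
qed

lemma universally_zero_foldr_SupQ:
  "wf_fm \<phi> \<Longrightarrow> wf_fm (foldr SupQ is \<phi>) \<and>
    (universally_zero (foldr SupQ is \<phi>) \<longleftrightarrow> universally_zero \<phi>)"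
  by (induction "is") (simp_all add: universally_zero_SupQ)

lemma universally_zero_sentence:
  assumes "fv \<sigma> = {}"
  shows "universally_zero \<sigma> \<longleftrightarrow> ev M d \<sigma> [] = 0"
proof -
  have "val M d \<sigma> s = ev M d \<sigma> []" for s
    unfolding ev_def by (rule val_cong) (simp add: assms)
  then show ?thesis by (simp add: universally_zero_def assms)
qed

end

lemma fv_foldr_SupQ [simp]: "fv (foldr SupQ is \<phi>) = fv \<phi> - set is"
  by (induction "is") auto

section \<open>Transfer of the extension property\<close>

text \<open>The values \<open>r\<close> satisfy the Katetov inequalities for the matrix
  \<open>D\<close>, whereas \<open>f\<close> has to satisfy them for the true distances, which
  differ from \<open>D\<close> by at most \<delta>. The greatest 1-Lipschitz function below the
  data, raised by \<delta> and cut off at 1, does so.\<close>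

lemma katetov_perturb:
  fixes n :: nat
  assumes "bounded_metric U e" and x: "\<And>i. i < n \<Longrightarrow> x i \<in> U"
    and D: "\<And>i j. i < n \<Longrightarrow> j < n \<Longrightarrow> \<bar>e (x i) (x j) - D i j\<bar> \<le> \<delta>"
    and r: "\<And>i. i < n \<Longrightarrow> 0 \<le> r i \<and> r i \<le> 1"
    and kat: "\<And>i j. i < n \<Longrightarrow> j < n \<Longrightarrow> r i \<le> r j + D i j \<and> D i j \<le> r i + r j"
    and "\<delta> \<ge> 0"
  obtains f where "katetov e (x ` {..<n}) f" "\<And>i. i < n \<Longrightarrow> \<bar>f (x i) - r i\<bar> \<le> \<delta>"
proof (cases "n = 0")
  case True
  then show thesis using that[of "\<lambda>_. 0"] by (simp add: katetov_def)
next
  interpret bounded_metric U e by fact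
  case False
  \<comment> \<open>The raise by \<delta> secures \<open>r i\<close> \<le> \<open>g (x i)\<close>,
    where the Lipschitz inequality for \<open>D\<close> loses \<delta>. It also covers the loss of
    \<delta> in the inequality for sums, since both summands are raised.\<close>
  define g where "g y = Min ((\<lambda>j. r j + e (x j) y) ` {..<n}) + \<delta>" for y
  have g_le: "g y \<le> r j + e (x j) y + \<delta>" if "j < n" for y j
    using that by (simp add: g_def Min_le)
  have g_ex: "\<exists>j<n. g y = r j + e (x j) y + \<delta>" for y
  proof -
    have "Min ((\<lambda>j. r j + e (x j) y) ` {..<n}) \<in> (\<lambda>j. r j + e (x j) y) ` {..<n}"
      using False by (intro Min_in) auto
    then show ?thesis by (auto simp: g_def)
  qed
  define f where "f y = min 1 (g y)" for y
  show thesis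
  proof (rule that[of f])
    have D': "e (x i) (x j) \<le> D i j + \<delta>" "D i j \<le> e (x i) (x j) + \<delta>" if "i < n" "j < n" for i j
      using D[OF that] by linarith+
    show "\<bar>f (x i) - r i\<bar> \<le> \<delta>" if i: "i < n" for i
    proof -
      obtain j where j: "j < n" "g (x i) = r j + e (x j) (x i) + \<delta>" using g_ex by blast
      have "r i \<le> g (x i)"
        using kat[OF i j(1)] D'(2)[OF i j(1)] j(2) commute[of "x i" "x j"] by linarith
      moreover have "g (x i) \<le> r i + \<delta>" using g_le[OF i, of "x i"] x[OF i] by simp
      ultimately show ?thesis using r[OF i] \<open>\<delta> \<ge> 0\<close> by (auto simp: f_def)
    qed
    have g_nonneg: "0 \<le> g y" for y
      using g_ex[of y] r \<open>\<delta> \<ge> 0\<close> by (force intro!: add_nonneg_nonneg)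
    have g_Lip: "g y \<le> g z + e y z" if "y \<in> U" "z \<in> U" for y z
    proof -
      obtain j where j: "j < n" "g z = r j + e (x j) z + \<delta>" using g_ex by blast
      then show ?thesis
        using g_le[OF j(1), of y] triangle[OF x[OF j(1)] that(2,1)] commute[of y z] by linarith
    qed
    have g_sum: "e y z \<le> g y + g z" if "y \<in> U" "z \<in> U" for y z
    proof -
      obtain j k where j: "j < n" "g y = r j + e (x j) y + \<delta>" and k: "k < n" "g z = r k + e (x k) z + \<delta>"
        using g_ex by meson
      have "e (x j) (x k) \<le> r j + r k + \<delta>"
        using kat[OF j(1) k(1)] D'(1)[OF j(1) k(1)] by linarith
      moreover have "e y z \<le> e y (x j) + e (x j) (x k) + e (x k) z"
        using triangle[OF that(1) x[OF j(1)] that(2)] triangle[OF x[OF j(1)] x[OF k(1)] that(2)]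
        by linarith
      ultimately show ?thesis using j(2) k(2) commute[of y "x j"] \<open>\<delta> \<ge> 0\<close> by linarith
    qed
    show "katetov e (x ` {..<n}) f"
      unfolding katetov_def
    proof (intro ballI conjI)
      fix y z assume "y \<in> x ` {..<n}" "z \<in> x ` {..<n}"
      then have yz: "y \<in> U" "z \<in> U" using x by auto
      show "f y \<le> f z + e y z" using g_Lip[OF yz] nonneg[of y z] unfolding f_def by linarith
      show "e y z \<le> f y + f z"
        using g_sum[OF yz] g_nonneg[of y] g_nonneg[of z] dist_le_1[OF yz] unfolding f_def by linarith
    qed (use g_nonneg in \<open>auto simp: f_def\<close>)
  qed
qed

text \<open>Nonemptiness comes from a one-point extension of the empty set.\<close>

lemma bounded_metric_urysohn:
  assumes "urysohn_sphere U e"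
  shows "bounded_metric U e"
proof -
  interpret Metric_space U e using assms by (simp add: urysohn_sphere_def)
  obtain z where "z \<in> U"
    using urysohn_one_point_extension[OF assms, of "{}" "\<lambda>_. 0"] by (auto simp: katetov_def)
  then show ?thesis
    using assms by unfold_locales (auto simp: urysohn_sphere_def)
qed

text \<open>The formula says that \<open>x\<^sub>n\<close> can be chosen so that its distances to \<open>x\<^sub>0, \<dots>, x\<^sub>n\<^sub>-\<^sub>1\<close> are
  as close to \<open>r\<close> as the distance matrix of \<open>x\<^sub>0, \<dots>, x\<^sub>n\<^sub>-\<^sub>1\<close> is to \<open>D\<close>.\<close>

definition extension_fm :: "nat \<Rightarrow> (nat \<Rightarrow> nat \<Rightarrow> real) \<Rightarrow> (nat \<Rightarrow> real) \<Rightarrow> fm" where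
  "extension_fm n D r = InfQ n (monus_fm
     (max_fm (map (\<lambda>i. near_fm (r i) (Dist n i)) [0..<n]))
     (max_fm (map (\<lambda>(i, j). near_fm (D i j) (Dist i j)) (List.product [0..<n] [0..<n]))))"

lemma wf_extension_fm:
  assumes "\<And>i j. i < n \<Longrightarrow> j < n \<Longrightarrow> D i j \<in> {0..1}" "\<And>i. i < n \<Longrightarrow> r i \<in> {0..1}"
  shows "wf_fm (extension_fm n D r)"
  unfolding extension_fm_def wf_fm.simps
  using assms by (intro wf_monus_fm wf_max_fm) (auto intro!: wf_near_fm)

lemma fv_extension_fm: "fv (extension_fm n D r) \<subseteq> {..<n}"
  by (auto simp: extension_fm_def)

text \<open>With \<delta> the discrepancy between the distance matrix of \<open>s\<close> and
  \<open>D\<close>, some Katetov function lies within \<delta> of \<open>r\<close>. The sphere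
  realizes it exactly, and that point makes the truncated difference 0.\<close>

lemma extension_fm_urysohn:
  assumes U: "urysohn_sphere U e"
    and D: "\<And>i j. i < n \<Longrightarrow> j < n \<Longrightarrow> D i j \<in> {0..1}" and r: "\<And>i. i < n \<Longrightarrow> r i \<in> {0..1}"
    and kat: "\<And>i j. i < n \<Longrightarrow> j < n \<Longrightarrow> r i \<le> r j + D i j \<and> D i j \<le> r i + r j"
    and s: "\<And>i. i < n \<Longrightarrow> s i \<in> U"
  shows "val U e (extension_fm n D r) s = 0"
proof -
  interpret bounded_metric U e by (rule bounded_metric_urysohn) (fact U)
  define A where "A = max_fm (map (\<lambda>i. near_fm (r i) (Dist n i)) [0..<n])"
  define B where "B = max_fm (map (\<lambda>(i, j). near_fm (D i j) (Dist i j)) (List.product [0..<n] [0..<n]))"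
  define \<delta> where "\<delta> = val U e B s"
  have "val U e B s \<le> \<delta>" by (simp add: \<delta>_def)
  then have \<delta>: "\<delta> \<ge> 0" "\<And>i j. i < n \<Longrightarrow> j < n \<Longrightarrow> \<bar>e (s i) (s j) - D i j\<bar> \<le> \<delta>"
    by (auto simp: B_def val_max_fm_le_iff)
  obtain f where f: "katetov e (s ` {..<n}) f" "\<And>i. i < n \<Longrightarrow> \<bar>f (s i) - r i\<bar> \<le> \<delta>"
    using r by (auto intro: katetov_perturb[OF bounded_metric_axioms s \<delta>(2) _ kat \<delta>(1)])
  obtain z where z: "z \<in> U" "\<And>x. x \<in> s ` {..<n} \<Longrightarrow> e z x = f x"
    using urysohn_one_point_extension[OF U _ _ f(1)] s by (auto simp: image_subset_iff)
  let ?v = "\<lambda>z. val U e (monus_fm A B) (s(n := z))"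
  \<comment> \<open>Only variables below \<open>n\<close> occur in \<open>B\<close>, so assigning
    \<open>n\<close> leaves its value unchanged.\<close>
  have "val U e B (s(n := z)) = \<delta>"
    unfolding \<delta>_def by (rule val_cong) (auto simp: B_def)
  moreover have "val U e A (s(n := z)) \<le> \<delta>"
    using \<delta>(1) f(2) z(2) by (simp add: A_def val_max_fm_le_iff)
  ultimately have "?v z = 0" by simp
  moreover have "bdd_below (?v ` U)" by (auto intro!: bdd_belowI[of _ 0])
  ultimately have "(INF z\<in>U. ?v z) \<le> 0"
    using z(1) by (intro cINF_lower2) auto
  moreover have "0 \<le> (INF z\<in>U. ?v z)"
    using nonempty by (intro cINF_greatest) auto
  ultimately show ?thesis by (simp add: extension_fm_def A_def B_def)
qed

text \<open>The universal closure of \<open>extension_fm\<close> belongs to the theory, hence holds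
  in \<open>M\<close>. It is applied with the exact distance matrix of \<open>A\<close>; its infimum
  need not be attained in \<open>M\<close>, which is why an error \<epsilon> remains.\<close>

lemma approximate_one_point_extension:
  assumes U: "urysohn_sphere U e" and M: "model M d (Th U e)"
    and A: "finite A" "A \<subseteq> M" "katetov d A f" and "\<epsilon> > 0"
  obtains z where "z \<in> M" "\<And>x. x \<in> A \<Longrightarrow> \<bar>d z x - f x\<bar> \<le> \<epsilon>"
proof -
  interpret U: bounded_metric U e by (rule bounded_metric_urysohn) (fact U)
  interpret Metric_space M d using M by (simp add: model_def)
  interpret bounded_metric M d using M by unfold_locales (auto simp: model_def)
  obtain xs where xs: "set xs = A" using finite_list[OF A(1)] by blast
  define n where "n = length xs"
  define D where "D i j = d (xs ! i) (xs ! j)" for i j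
  define r where "r i = f (xs ! i)" for i
  have xs_A: "xs ! i \<in> A" if "i < n" for i using that xs by (auto simp: n_def)
  have xs_M: "xs ! i \<in> M" if "i < n" for i using xs_A that A(2) by blast
  have D: "D i j \<in> {0..1}" if "i < n" "j < n" for i j
    using that xs_M dist_le_1 by (simp add: D_def)
  have r: "r i \<in> {0..1}" if "i < n" for i
    using katetovD(1,2)[OF A(3) xs_A[OF that]] by (simp add: r_def)
  have kat: "r i \<le> r j + D i j \<and> D i j \<le> r i + r j" if "i < n" "j < n" for i j
    using katetovD(3,4)[OF A(3) xs_A[OF that(1)] xs_A[OF that(2)]] by (simp add: r_def D_def)
  let ?\<phi> = "extension_fm n D r"
  define \<sigma> where "\<sigma> = foldr SupQ [0..<n] ?\<phi>"
  have wf: "wf_fm ?\<phi>" by (rule wf_extension_fm) (fact D r)+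
  have fv: "fv \<sigma> = {}" using fv_extension_fm[of n D r] by (auto simp: \<sigma>_def)
  obtain y where "y \<in> M" using nonempty by blast
  define s where "s i = (if i < n then xs ! i else y)" for i
  have s_M: "s i \<in> M" for i using xs_M \<open>y \<in> M\<close> by (simp add: s_def)
  define P where "P = max_fm (map (\<lambda>i. near_fm (r i) (Dist n i)) [0..<n])"
  define Q where "Q = max_fm (map (\<lambda>(i, j). near_fm (D i j) (Dist i j)) (List.product [0..<n] [0..<n]))"
  let ?v = "\<lambda>z. val M d (monus_fm P Q) (s(n := z))"
  have "U.universally_zero ?\<phi>"
    unfolding U.universally_zero_def
  proof (intro allI impI)
    fix t assume t: "t ` fv ?\<phi> \<subseteq> U"
    obtain u where "u \<in> U" using U.nonempty by blast
    \<comment> \<open>The assignment \<open>t\<close> is known to take values in \<open>U\<close>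
      only on the free variables; elsewhere a fixed point of \<open>U\<close> is used.\<close>
    define t' where "t' i = (if i \<in> fv ?\<phi> then t i else u)" for i
    have "val U e ?\<phi> t = val U e ?\<phi> t'" by (rule val_cong) (simp add: t'_def)
    also have "\<dots> = 0"
      using t \<open>u \<in> U\<close> by (intro extension_fm_urysohn[OF U D r kat]) (auto simp: t'_def)
    finally show "val U e ?\<phi> t = 0" .
  qed
  then have "U.universally_zero \<sigma>" using U.universally_zero_foldr_SupQ[OF wf] by (simp add: \<sigma>_def)
  then have "\<sigma> \<in> Th U e"
    using U.universally_zero_sentence[OF fv] universally_zero_foldr_SupQ[OF wf, of "[0..<n]"] fv
    by (simp add: Th_def formula_def \<sigma>_def)
  then have "ev M d \<sigma> [] = 0" using M by (simp add: model_def)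
  then have "universally_zero ?\<phi>"
    using universally_zero_sentence[OF fv] universally_zero_foldr_SupQ[OF wf] by (simp add: \<sigma>_def)
  then have "(INF z\<in>M. ?v z) = 0"
    using s_M by (auto simp: universally_zero_def extension_fm_def P_def Q_def)
  then have "(INF z\<in>M. ?v z) < \<epsilon>" using \<open>\<epsilon> > 0\<close> by simp
  moreover have "bdd_below (?v ` M)" by (auto intro!: bdd_belowI[of _ 0])
  ultimately obtain z where z: "z \<in> M" "?v z < \<epsilon>"
    using cINF_less_iff[of M ?v \<epsilon>] nonempty by blast
  \<comment> \<open>Since \<open>D\<close> is the distance matrix of \<open>xs\<close> itself,
    nothing is subtracted and the bound on the truncated difference is a bound on
    \<open>P\<close>.\<close>
  have "val M d Q (s(n := z)) \<le> 0"
    by (simp add: Q_def val_max_fm_le_iff) (simp add: s_def D_def)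
  then have "val M d P (s(n := z)) \<le> \<epsilon>" using z(2) by simp
  then have *: "\<bar>d z (xs ! i) - f (xs ! i)\<bar> \<le> \<epsilon>" if "i < n" for i
    using that by (auto simp: P_def val_max_fm_le_iff s_def r_def)
  show thesis
    using z(1) * xs by (intro that[of z]) (auto simp: in_set_conv_nth n_def)
qed

section \<open>Bounds on the distance over a set\<close>

text \<open>This is the right-hand side of (iii). The triangle inequality through points of
  \<open>C\<close> makes it a lower bound for \<open>d a b\<close>, as \<open>d_max\<close> is an
  upper bound.\<close>

definition d_min :: "('a \<Rightarrow> 'a \<Rightarrow> real) \<Rightarrow> 'a \<Rightarrow> 'a \<Rightarrow> 'a set \<Rightarrow> real" where
  "d_min d a b C = sup01 ((\<lambda>c. \<bar>d a c - d b c\<bar>) ` C)"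

context bounded_metric
begin

lemma d_max_le_1: "d_max d a b C \<le> 1"
  and d_max_le: "c \<in> C \<Longrightarrow> d_max d a b C \<le> d a c + d b c"
proof -
  have bdd: "bdd_below ((\<lambda>c. min (d a c + d b c) 1) ` C)"
    by (auto intro!: bdd_belowI[of _ 0])
  have *: "d_max d a b C \<le> min (d a c + d b c) 1" if "c \<in> C" for c
    using that cINF_lower[OF bdd that] by (auto simp: d_max_def inf01_def)
  then show "c \<in> C \<Longrightarrow> d_max d a b C \<le> d a c + d b c" by force
  show "d_max d a b C \<le> 1"
    using * by (cases "C = {}") (force simp: d_max_def inf01_def)+
qed

lemma d_max_greatest:
  assumes "t \<le> 1" "\<And>c. c \<in> C \<Longrightarrow> t \<le> d a c + d b c"
  shows "t \<le> d_max d a b C"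
  unfolding d_max_def inf01_def using assms by (auto intro!: cINF_greatest)

lemma d_min_ge:
  assumes "C \<subseteq> M" "a \<in> M" "b \<in> M" "c \<in> C"
  shows "\<bar>d a c - d b c\<bar> \<le> d_min d a b C"
proof -
  have "\<bar>d a c - d b c\<bar> \<le> 1" if "c \<in> C" for c
  proof -
    have "c \<in> M" using that assms(1) by blast
    then show ?thesis
      using dist_le_1[OF assms(2)] dist_le_1[OF assms(3)] nonneg[of a c] nonneg[of b c]
      by (smt (verit))
  qed
  then have "bdd_above ((\<lambda>c. \<bar>d a c - d b c\<bar>) ` C)"
    by (auto intro!: bdd_aboveI[of _ 1])
  from cSUP_upper[OF assms(4) this] assms(4) show ?thesis
    by (auto simp: d_min_def sup01_def)
qed

lemma d_min_least:
  assumes "0 \<le> t" "\<And>c. c \<in> C \<Longrightarrow> \<bar>d a c - d b c\<bar> \<le> t"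
  shows "d_min d a b C \<le> t"
  unfolding d_min_def sup01_def using assms by (auto intro!: cSUP_least)

lemma d_min_nonneg:
  assumes "C \<subseteq> M" "a \<in> M" "b \<in> M"
  shows "0 \<le> d_min d a b C"
proof (cases "C = {}")
  case False
  then obtain c where "c \<in> C" by blast
  then show ?thesis using d_min_ge[OF assms] abs_ge_zero order_trans by blast
qed (simp add: d_min_def sup01_def)

lemma d_max_cong:
  assumes "\<And>c. c \<in> C \<Longrightarrow> d b c = d b' c"
  shows "d_max d a b C = d_max d a b' C"
proof -
  have "(\<lambda>c. min (d a c + d b c) 1) ` C = (\<lambda>c. min (d a c + d b' c) 1) ` C"
    using assms by (intro image_cong) auto
  then show ?thesis by (simp only: d_max_def)
qed

lemma d_min_cong:
  assumes "\<And>c. c \<in> C \<Longrightarrow> d b c = d b' c"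
  shows "d_min d a b C = d_min d a b' C"
proof -
  have "(\<lambda>c. \<bar>d a c - d b c\<bar>) ` C = (\<lambda>c. \<bar>d a c - d b' c\<bar>) ` C"
    using assms by (intro image_cong) auto
  then show ?thesis by (simp only: d_min_def)
qed

section \<open>Inequalities between the two bounds\<close>

context
  fixes C assumes C: "C \<subseteq> M"
begin

lemma d_min_le_dist: "x \<in> M \<Longrightarrow> y \<in> M \<Longrightarrow> d_min d x y C \<le> d x y"
proof (rule d_min_least)
  fix c assume "x \<in> M" "y \<in> M" "c \<in> C"
  then show "\<bar>d x c - d y c\<bar> \<le> d x y"
    using C triangle[of x y c] triangle[of y x c] commute[of x y] by (auto simp: abs_le_iff)
qed simp

lemma dist_le_d_max: "x \<in> M \<Longrightarrow> y \<in> M \<Longrightarrow> d x y \<le> d_max d x y C"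
proof (rule d_max_greatest)
  fix c assume "x \<in> M" "y \<in> M" "c \<in> C"
  then show "d x y \<le> d x c + d y c" using C triangle[of x c y] commute[of c y] by auto
qed (rule dist_le_1)

text \<open>Replacing \<open>x\<close> by \<open>y\<close> changes each distance to \<open>C\<close>
  by at most \<open>d_min d x y C\<close>.\<close>

lemma d_max_Lipschitz:
  assumes "a \<in> M" "x \<in> M" "y \<in> M"
  shows "d_max d a x C \<le> d_max d a y C + d_min d x y C"
proof -
  have "d_max d a x C - d_min d x y C \<le> d_max d a y C"
  proof (rule d_max_greatest)
    show "d_max d a x C - d_min d x y C \<le> 1"
      using d_max_le_1[of a x C] d_min_nonneg[OF C assms(2,3)] by linarith
    show "d_max d a x C - d_min d x y C \<le> d a c + d y c" if "c \<in> C" for c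
      using d_max_le[OF that, of a x] d_min_ge[OF C assms(2,3) that] by linarith
  qed
  then show ?thesis by simp
qed

lemma d_min_triangle:
  assumes "x \<in> M" "y \<in> M" "z \<in> M"
  shows "d_min d z x C \<le> d_min d z y C + d_min d x y C"
proof (rule d_min_least)
  show "0 \<le> d_min d z y C + d_min d x y C"
    using d_min_nonneg[OF C] assms by (intro add_nonneg_nonneg)
  show "\<bar>d z c - d x c\<bar> \<le> d_min d z y C + d_min d x y C" if "c \<in> C" for c
    using d_min_ge[OF C assms(3,2) that] d_min_ge[OF C assms(1,2) that] by linarith
qed

text \<open>For \<open>c\<close> and \<open>c'\<close> in \<open>C\<close>, the point
  \<open>c\<close> is used as the midpoint between \<open>x\<close> and \<open>y\<close>, and
  \<open>d y c\<close> is estimated along the route from \<open>y\<close> through \<open>c'\<close>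
  and \<open>a\<close> to \<open>c\<close>. Infima over \<open>c'\<close> and then \<open>c\<close>
  are taken.\<close>

lemma d_max_le_add:
  assumes "a \<in> M" "x \<in> M" "y \<in> M"
  shows "d_max d x y C \<le> d_max d a x C + d_max d a y C"
proof -
  have nonneg': "0 \<le> d_max d a z C" for z by (rule d_max_greatest) auto
  have "d_max d x y C - d_max d a y C \<le> d_max d a x C"
  proof (rule d_max_greatest)
    fix c assume c: "c \<in> C"
    have "d_max d x y C - (d a c + d x c) \<le> d_max d a y C"
    proof (rule d_max_greatest)
      fix c' assume c': "c' \<in> C"
      have "d y c \<le> d y c' + d a c' + d a c"
        using triangle[of y c' c] triangle[of c' a c] commute[of a c'] c c' C assms by (auto simp: subset_iff)
      then show "d_max d x y C - (d a c + d x c) \<le> d a c' + d y c'"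
        using d_max_le[OF c, of x y] by linarith
    qed (use d_max_le_1[of x y C] nonneg[of a c] nonneg[of x c] in linarith)
    then show "d_max d x y C - d_max d a y C \<le> d a c + d x c" by linarith
  qed (use d_max_le_1[of x y C] nonneg'[of y] in linarith)
  then show ?thesis by simp
qed

text \<open>Write m for \<open>d_max d a b C\<close>. If 2m \<le> \<open>d_max d b b C\<close>, then
  every \<open>d b c\<close> is at least m, so \<open>d a c + d b c\<close> is at least 2m minus
  \<open>d_min d a b C\<close>. Taking the infimum gives m \<le> \<open>d_min d a b C\<close>, a
  contradiction. The lemma leaves room for a nonforking extension below the upper bound.\<close>

lemma d_max_half_lt:
  assumes "a \<in> M" "b \<in> M" and lt: "d_min d a b C < d_max d a b C"
  shows "d_max d b b C < 2 * d_max d a b C"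
proof (rule ccontr)
  assume "\<not> ?thesis"
  then have ge: "2 * d_max d a b C \<le> d_max d b b C" by simp
  let ?m = "d_max d a b C"
  \<comment> \<open>This keeps the lower bound 2m minus \<open>d_min d a b C\<close> below the
    truncation value 1.\<close>
  have "?m \<le> 1/2" using ge d_max_le_1[of b b C] by simp
  have *: "2 * ?m - d_min d a b C \<le> d a c + d b c" if "c \<in> C" for c
    using d_max_le[OF that, of b b] ge d_min_ge[OF C assms(1,2) that] by linarith
  have "2 * ?m - d_min d a b C \<le> ?m"
    using \<open>?m \<le> 1/2\<close> d_min_nonneg[OF C assms(1,2)] * by (intro d_max_greatest) auto
  then show False using lt by simp
qed

subsection \<open>An extension of the distance function of a point\<close>

text \<open>The first term puts \<open>y\<close> as far from the new point as \<open>C\<close>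
  permits; the second lowers the value to \<open>r\<close> at \<open>b\<close>. Using
  \<open>d_min d b y C\<close> instead of \<open>d b y\<close> makes the result depend on
  \<open>y\<close> only through its distances to \<open>C\<close>.\<close>

definition free_ext :: "'a \<Rightarrow> 'a \<Rightarrow> real \<Rightarrow> 'a \<Rightarrow> real" where
  "free_ext a b r y = min (d_max d a y C) (r + d_min d b y C)"

lemma free_ext_cong:
  assumes "\<And>c. c \<in> C \<Longrightarrow> d y c = d y' c"
  shows "free_ext a b r y = free_ext a b r y'"
  using d_max_cong[OF assms] d_min_cong[OF assms] by (simp add: free_ext_def)

context
  fixes a b r
  assumes a: "a \<in> M" and b: "b \<in> M"
    and r_ge: "d_min d a b C \<le> r" and r_le: "r \<le> d_max d a b C" and r_half: "d_max d b b C \<le> 2 * r"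
begin

lemma free_ext_base: "free_ext a b r b = r"
proof -
  have "d_min d b b C = 0"
    using d_min_nonneg[OF C b b] d_min_least[of 0 C b b] by simp
  then show ?thesis using r_le by (simp add: free_ext_def)
qed

text \<open>With \<open>c\<close> itself as witness, \<open>d_max d a c C\<close> equals
  \<open>d a c\<close>. The second term is no smaller, since \<open>d_min d b c C\<close> is at
  least \<open>d b c\<close> and \<open>r\<close> is at least the difference of \<open>d a c\<close>
  and \<open>d b c\<close>.\<close>

lemma free_ext_on:
  assumes "c \<in> C"
  shows "free_ext a b r c = d a c"
proof -
  have "c \<in> M" using assms C by blast
  have "d_max d a c C \<le> d a c" using d_max_le[OF assms, of a c] \<open>c \<in> M\<close> by simp
  then have "d_max d a c C = d a c" using dist_le_d_max[OF a \<open>c \<in> M\<close>] by simp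
  moreover have "d a c \<le> r + d_min d b c C"
    using d_min_ge[OF C a b assms] d_min_ge[OF C b \<open>c \<in> M\<close> assms] \<open>c \<in> M\<close> r_ge by simp
  ultimately show ?thesis by (simp add: free_ext_def)
qed

text \<open>Both bounds only involve the types of \<open>x\<close> and \<open>y\<close> over \<open>C\<close>; so this function can be
  realized simultaneously on arbitrarily many realizations of a type over \<open>C\<close>.\<close>

lemma katetov_free_ext: "katetov d M (free_ext a b r)"
proof -
  let ?g = "free_ext a b r"
  have r0: "0 \<le> r" using d_min_nonneg[OF C a b] r_ge by simp
  have "0 \<le> ?g x" if "x \<in> M" for x
    using r0 d_min_nonneg[OF C b that] d_max_greatest[of 0 C a x] by (simp add: free_ext_def)
  moreover have "?g x \<le> 1" for x using d_max_le_1[of a x C] by (simp add: free_ext_def)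
  moreover have "?g x \<le> ?g y + d x y" if "x \<in> M" "y \<in> M" for x y
  proof -
    have "?g x \<le> ?g y + d_min d x y C"
      using d_max_Lipschitz[OF a that] d_min_triangle[OF that b] unfolding free_ext_def by linarith
    then show ?thesis using d_min_le_dist[OF that] by simp
  qed
  moreover have "d x y \<le> ?g x + ?g y" if x: "x \<in> M" and y: "y \<in> M" for x y
  proof -
    \<comment> \<open>The two minima give four cases. Two first terms are handled by
      \<open>d_max_le_add\<close>, one of each kind by \<open>mixed\<close> and r \<ge>
      \<open>d_min d a b C\<close>, and two second terms by the hypothesis
      \<open>r_half\<close>.\<close>
    have mixed: "d_max d x y C \<le> d_max d a x C + (r + d_min d b y C)" if xy: "x \<in> M" "y \<in> M" for x y
    proof -
      have "d_max d x y C - (r + d_min d b y C) \<le> d_max d a x C"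
      proof (rule d_max_greatest)
        show "d_max d x y C - (r + d_min d b y C) \<le> 1"
          using d_max_le_1[of x y C] r0 d_min_nonneg[OF C b xy(2)] by linarith
        show "d_max d x y C - (r + d_min d b y C) \<le> d a c + d x c" if c: "c \<in> C" for c
          using d_max_le[OF c, of x y] d_min_ge[OF C a b c] d_min_ge[OF C b xy(2) c] r_ge by linarith
      qed
      then show ?thesis by simp
    qed
    have swap: "d_max d x y C = d_max d y x C" by (simp add: d_max_def add.commute)
    have "d_max d x y C - d_min d b x C - d_min d b y C \<le> d_max d b b C"
    proof (rule d_max_greatest)
      show "d_max d x y C - d_min d b x C - d_min d b y C \<le> 1"
        using d_max_le_1[of x y C] d_min_nonneg[OF C b x] d_min_nonneg[OF C b y] by linarith
      show "d_max d x y C - d_min d b x C - d_min d b y C \<le> d b c + d b c" if c: "c \<in> C" for c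
        using d_max_le[OF c, of x y] d_min_ge[OF C b x c] d_min_ge[OF C b y c] by linarith
    qed
    then have "d_max d x y C \<le> ?g x + ?g y"
      using mixed[OF x y] mixed[OF y x] swap d_max_le_add[OF a x y] r_half
      unfolding free_ext_def by linarith
    then show ?thesis using dist_le_d_max[OF x y] by simp
  qed
  ultimately show ?thesis by (simp add: katetov_def)
qed

end

end

end

section \<open>Saturated models\<close>

lemma realizesD: "realizes M d xs p \<Longrightarrow> (\<phi>, bs) \<in> p \<Longrightarrow> ev M d \<phi> (xs @ bs) = 0"
  by (auto simp: realizes_def)

locale urysohn_monster = bounded_metric M d
  for M :: "'a set" and d +
  fixes \<kappa> :: "'k rel" and U :: "'u set" and e
  assumes urysohn: "urysohn_sphere U e"
    and monster: "monster_model \<kappa> M d (Th U e)"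
begin

section \<open>Realization of consistent types and of Katetov functions\<close>

lemma small_Un: "|A| <o \<kappa> \<Longrightarrow> |B| <o \<kappa> \<Longrightarrow> |A \<union> B| <o \<kappa>"
proof (rule card_of_Un_ordLess_infinite_Field)
  show co: "Card_order \<kappa>" using monster by (simp add: monster_model_def)
  have "natLeq <o \<kappa>" using monster by (simp add: monster_model_def)
  then have "natLeq \<le>o |Field \<kappa>|"
    using card_of_Field_ordIso[OF co] ordLess_imp_ordLeq ordIso_symmetric ordLeq_ordIso_trans by blast
  then show "infinite (Field \<kappa>)" by (metis infinite_iff_natLeq_ordLeq)
qed

lemma finite_small:
  assumes "finite A"
  shows "|A| <o \<kappa>"
proof -
  have "natLeq <o \<kappa>" using monster by (simp add: monster_model_def)
  with assms show ?thesis
    unfolding finite_iff_ordLess_natLeq by (rule ordLess_transitive)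
qed

lemma ev_in_01:
  assumes "formula (length xs) \<phi>" "set xs \<subseteq> M"
  shows "ev M d \<phi> xs \<in> {0..1}"
  unfolding ev_def
proof (rule val_in_01)
  show "wf_fm \<phi>" using assms(1) by (simp add: formula_def)
  show "(\<lambda>i. xs ! i) ` fv \<phi> \<subseteq> M"
  proof (rule image_subsetI)
    fix i assume "i \<in> fv \<phi>"
    then have "i < length xs" using assms(1) by (auto simp: formula_def)
    then show "xs ! i \<in> M" using assms(2) nth_mem by blast
  qed
qed

text \<open>\<open>saturated\<close> wants finite parts satisfied exactly, while
  \<open>consistent\<close> provides approximations only. Each condition \<phi> = 0 is therefore
  replaced by all conditions \<phi> \<le> 1/(k+1), whose finite parts are satisfied exactly.\<close>

lemma realized_of_consistent:
  assumes A: "A \<subseteq> M" "|A| <o \<kappa>" and p: "p \<subseteq> formulas_over n A" "consistent M d n p"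
  obtains xs where "xs \<in> tuples M n" "realizes M d xs p"
proof -
  define h where "h q = (case q of ((\<phi>, bs), k) \<Rightarrow> (shrink_fm (1 / real (Suc k)) \<phi>, bs))"
    for q :: "(fm \<times> 'a list) \<times> nat"
  let ?p' = "h ` (p \<times> UNIV)"
  have p_form: "set bs \<subseteq> A" "wf_fm \<phi>" "fv \<phi> \<subseteq> {..<n + length bs}" if "(\<phi>, bs) \<in> p" for \<phi> bs
    using p(1) that by (auto simp: formulas_over_def formula_def)
  have "?p' \<subseteq> formulas_over n A"
  proof (rule image_subsetI)
    fix q assume "q \<in> p \<times> (UNIV :: nat set)"
    then obtain \<phi> bs k where "q = ((\<phi>, bs), k)" "(\<phi>, bs) \<in> p" by (metis SigmaE surj_pair)
    then show "h q \<in> formulas_over n A"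
      using p_form by (simp add: h_def formulas_over_def formula_def wf_shrink_fm)
  qed
  moreover have "\<exists>xs\<in>tuples M n. realizes M d xs F" if F: "finite F" "F \<subseteq> ?p'" for F
  proof -
    obtain G where G: "G \<subseteq> p \<times> UNIV" "finite G" "F = h ` G"
      using finite_subset_image[OF F] by blast
    \<comment> \<open>The largest index gives the strictest tolerance occurring in
      \<open>F\<close>.\<close>
    define N where "N = Max (snd ` G)"
    have "finite (fst ` G)" "fst ` G \<subseteq> p" "1 / real (Suc N) > 0" using G by auto
    then obtain xs where xs: "xs \<in> tuples M n"
      "\<forall>(\<phi>, bs)\<in>fst ` G. ev M d \<phi> (xs @ bs) \<le> 1 / real (Suc N)"
      using p(2) unfolding consistent_def by blast
    have "ev M d (shrink_fm (1 / real (Suc k)) \<phi>) (xs @ bs) = 0" if "((\<phi>, bs), k) \<in> G" for \<phi> bs k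
    proof -
      have "k \<in> snd ` G" using imageI[OF that, of snd] by simp
      then have "k \<le> N" using G(2) unfolding N_def by (intro Max_ge finite_imageI)
      then have "1 / real (Suc N) \<le> 1 / real (Suc k)" by (simp add: field_simps)
      moreover have "ev M d \<phi> (xs @ bs) \<le> 1 / real (Suc N)"
        using xs(2) imageI[OF that, of fst] by fastforce
      ultimately show ?thesis by (simp add: ev_def)
    qed
    then have "realizes M d xs F" by (auto simp: realizes_def G(3) h_def)
    then show ?thesis using xs(1) by blast
  qed
  ultimately obtain xs where xs: "xs \<in> tuples M n" "realizes M d xs ?p'"
    using monster A unfolding monster_model_def saturated_def by blast
  have "ev M d \<phi> (xs @ bs) = 0" if q: "(\<phi>, bs) \<in> p" for \<phi> bs
  proof -
    have f: "formula (length (xs @ bs)) \<phi>" "set (xs @ bs) \<subseteq> M"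
      using p_form[OF q] xs(1) A(1) by (simp_all add: formula_def tuples_def subset_iff)
    have "ev M d \<phi> (xs @ bs) \<le> 0 + 1 / real (Suc k)" for k
    proof -
      have "h ((\<phi>, bs), k) \<in> ?p'" using q by blast
      then have "(shrink_fm (1 / real (Suc k)) \<phi>, bs) \<in> ?p'" by (simp only: h_def case_prod_conv)
      then have "ev M d (shrink_fm (1 / real (Suc k)) \<phi>) (xs @ bs) = 0"
        by (rule realizesD[OF xs(2)])
      then show ?thesis by (simp add: ev_def)
    qed
    then have "ev M d \<phi> (xs @ bs) \<le> 0"
      by (metis add_0 nat_approx_posE not_le)
    then show ?thesis using ev_in_01[OF f] by simp
  qed
  then show thesis using that[OF xs(1)] by (auto simp: realizes_def)
qed

text \<open>The conditions d(x,c) = f(c) for \<open>c\<close> in \<open>A\<close> are consistent by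
  the approximate extensions over finite subsets, and saturation removes the error.\<close>

lemma one_point_extension:
  assumes A: "A \<subseteq> M" "|A| <o \<kappa>" "katetov d A f"
  obtains z where "z \<in> M" "\<And>x. x \<in> A \<Longrightarrow> d z x = f x"
proof -
  define p where "p = (\<lambda>x. (near_fm (f x) (Dist 0 1), [x])) ` A"
  have "p \<subseteq> formulas_over 1 A"
    unfolding p_def
  proof (rule image_subsetI)
    fix x assume "x \<in> A"
    then show "(near_fm (f x) (Dist 0 1), [x]) \<in> formulas_over 1 A"
      using katetovD(1,2)[OF A(3)] by (simp add: formulas_over_def formula_def wf_near_fm)
  qed
  moreover have "consistent M d 1 p"
    unfolding consistent_def
  proof (intro allI impI)
    fix F \<epsilon> assume F: "finite F \<and> F \<subseteq> p \<and> 0 < (\<epsilon>::real)"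
    then obtain A0 where A0: "A0 \<subseteq> A" "finite A0" "F = (\<lambda>x. (near_fm (f x) (Dist 0 1), [x])) ` A0"
      using finite_subset_image[of F _ A] unfolding p_def by blast
    have "model M d (Th U e)" "A0 \<subseteq> M" "0 < \<epsilon>"
      using monster A0(1) A(1) F by (auto simp: monster_model_def)
    then obtain z where z: "z \<in> M" "\<And>x. x \<in> A0 \<Longrightarrow> \<bar>d z x - f x\<bar> \<le> \<epsilon>"
      using approximate_one_point_extension[OF urysohn _ A0(2) _ katetov_subset[OF A(3) A0(1)]]
      by blast
    then have "[z] \<in> tuples M 1" "\<forall>(\<phi>, bs)\<in>F. ev M d \<phi> ([z] @ bs) \<le> \<epsilon>"
      by (auto simp: tuples_def A0(3) ev_def)
    then show "\<exists>xs\<in>tuples M 1. \<forall>(\<phi>, bs)\<in>F. ev M d \<phi> (xs @ bs) \<le> \<epsilon>" by blast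
  qed
  ultimately obtain xs where xs: "xs \<in> tuples M 1" "realizes M d xs p"
    using realized_of_consistent[OF A(1,2)] by blast
  then obtain z where "xs = [z]" "z \<in> M" by (auto simp: tuples_def length_Suc_conv)
  moreover have "d z x = f x" if "x \<in> A" for x
    using xs(2) that by (simp add: realizes_def p_def ev_def \<open>xs = [z]\<close>)
  ultimately show thesis using that by blast
qed


text \<open>Quantifier elimination, in semantic form: one-point extensions give the back-and-forth step
  at each quantifier.\<close>

lemma val_eq_of_dist_eq:
  assumes "s ` fv \<phi> \<subseteq> M" "t ` fv \<phi> \<subseteq> M"
    and "\<And>i j. i \<in> fv \<phi> \<Longrightarrow> j \<in> fv \<phi> \<Longrightarrow> d (s i) (s j) = d (t i) (t j)"
  shows "val M d \<phi> s = val M d \<phi> t"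
proof -
  have step: "\<exists>y\<in>M. \<forall>j\<in>J. d y (t j) = d x (s j)"
    if J: "finite J" and sM: "s ` J \<subseteq> M" and tM: "t ` J \<subseteq> M" and st: "\<And>i j. i \<in> J \<Longrightarrow> j \<in> J \<Longrightarrow> d (s i) (s j) = d (t i) (t j)"
      and x: "x \<in> M" for s t :: "nat \<Rightarrow> 'a" and J x
  proof -
    \<comment> \<open>As \<open>t\<close> may repeat values on \<open>J\<close>, an index is chosen.
      Indices with equal values under \<open>t\<close> have distance 0 under \<open>s\<close> as
      well, so the choice does not affect \<open>f\<close>.\<close>
    define f where "f y = d x (s (SOME j. j \<in> J \<and> t j = y))" for y
    have f: "f (t j) = d x (s j)" if j: "j \<in> J" for j
    proof -
      let ?i = "SOME i. i \<in> J \<and> t i = t j"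
      have i: "?i \<in> J \<and> t ?i = t j" 
        by (rule someI[of "\<lambda>i. i \<in> J \<and> t i = t j" j]) (use j in simp)
      then have "d (s ?i) (s j) = 0"
        using tM st[of ?i j] i j by (simp add: image_subset_iff)
      then have "s ?i = s j" using i j sM by (simp add: image_subset_iff)
      then show ?thesis by (simp add: f_def)
    qed
    have "katetov d (s ` J) (d x)"
      using katetov_dist[OF bounded_metric_axioms sM x] .
    then have "katetov d (t ` J) f"
      using f st by (simp add: katetov_def)
    then obtain y where y: "y \<in> M" "\<And>z. z \<in> t ` J \<Longrightarrow> d y z = f z"
      using one_point_extension[OF tM finite_small] J by blast
    have "\<forall>j\<in>J. d y (t j) = d x (s j)" using f y(2) by simp
    then show ?thesis using y(1) by blast
  qed
  \<comment> \<open>Equality of the sets of values settles both quantifiers at once, and by symmetry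
    one inclusion suffices.\<close>
  have range_eq: "(\<lambda>x. val M d \<phi> (s(i := x))) ` M = (\<lambda>x. val M d \<phi> (t(i := x))) ` M"
    if IH: "\<And>s t. s ` fv \<phi> \<subseteq> M \<Longrightarrow> t ` fv \<phi> \<subseteq> M \<Longrightarrow>
        (\<And>i j. i \<in> fv \<phi> \<Longrightarrow> j \<in> fv \<phi> \<Longrightarrow> d (s i) (s j) = d (t i) (t j)) \<Longrightarrow>
        val M d \<phi> s = val M d \<phi> t"
      and "s ` (fv \<phi> - {i}) \<subseteq> M" "t ` (fv \<phi> - {i}) \<subseteq> M"
      "\<And>j k. j \<in> fv \<phi> - {i} \<Longrightarrow> k \<in> fv \<phi> - {i} \<Longrightarrow> d (s j) (s k) = d (t j) (t k)" for \<phi> i s t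
  proof -
    have sub: "(\<lambda>x. val M d \<phi> (s(i := x))) ` M \<subseteq> (\<lambda>x. val M d \<phi> (t(i := x))) ` M"
      if st: "s ` (fv \<phi> - {i}) \<subseteq> M" "t ` (fv \<phi> - {i}) \<subseteq> M"
        "\<And>j k. j \<in> fv \<phi> - {i} \<Longrightarrow> k \<in> fv \<phi> - {i} \<Longrightarrow> d (s j) (s k) = d (t j) (t k)"
      for s t
    proof (rule image_subsetI)
      fix x assume "x \<in> M"
      then obtain y where y: "y \<in> M" "\<forall>j\<in>fv \<phi> - {i}. d y (t j) = d x (s j)"
        using step[OF _ st] finite_fv[of \<phi>] by blast
      moreover have "d (t j) y = d (s j) x" if "j \<in> fv \<phi> - {i}" for j
        using y(2) that by (simp only: commute[of _ x] commute[of _ y])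
      ultimately have "val M d \<phi> (s(i := x)) = val M d \<phi> (t(i := y))"
        using st \<open>x \<in> M\<close> by (intro IH) (auto simp: image_subset_iff)
      then show "val M d \<phi> (s(i := x)) \<in> (\<lambda>x. val M d \<phi> (t(i := x))) ` M" using y(1) by simp
    qed
    show ?thesis
      using that(2-) by (intro equalityI sub) auto
  qed
  show ?thesis
    using assms
  proof (induction \<phi> arbitrary: s t)
    case (Dist i j)
    then show ?case by simp
  next
    case (Conn u \<phi>s)
    have "val M d \<phi> s = val M d \<phi> t" if "\<phi> \<in> set \<phi>s" for \<phi>
    proof -
      have "fv \<phi> \<subseteq> fv (Conn u \<phi>s)" using that by auto
      then show ?thesis
        using Conn.prems by (intro Conn.IH[OF that]) blast+
    qed
    then have "map (\<lambda>\<phi>. val M d \<phi> s) \<phi>s = map (\<lambda>\<phi>. val M d \<phi> t) \<phi>s"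
      by (intro map_cong refl)
    then show ?case by (simp only: val.simps)
  next
    case (SupQ i \<phi>)
    have "(\<lambda>x. val M d \<phi> (s(i := x))) ` M = (\<lambda>x. val M d \<phi> (t(i := x))) ` M"
      using SupQ.prems by (intro range_eq SupQ.IH) auto
    then show ?case by (simp only: val.simps)
  next
    case (InfQ i \<phi>)
    have "(\<lambda>x. val M d \<phi> (s(i := x))) ` M = (\<lambda>x. val M d \<phi> (t(i := x))) ` M"
      using InfQ.prems by (intro range_eq InfQ.IH) auto
    then show ?case by (simp only: val.simps)
  qed
qed


section \<open>Types\<close>

lemma ev_eq_of_dist_eq:
  assumes "formula (length zs) \<phi>" "length zs' = length zs" "set zs \<subseteq> M" "set zs' \<subseteq> M"
    and dist: "\<And>i j. i < length zs \<Longrightarrow> j < length zs \<Longrightarrow> d (zs ! i) (zs ! j) = d (zs' ! i) (zs' ! j)"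
  shows "ev M d \<phi> zs = ev M d \<phi> zs'"
  unfolding ev_def
proof (rule val_eq_of_dist_eq)
  have less: "i < length zs" if "i \<in> fv \<phi>" for i using assms(1) that by (auto simp: formula_def)
  show "(\<lambda>i. zs ! i) ` fv \<phi> \<subseteq> M"
    using less assms(3) by (metis image_subsetI nth_mem subsetD)
  show "(\<lambda>i. zs' ! i) ` fv \<phi> \<subseteq> M"
    using less assms(2,4) by (metis image_subsetI nth_mem subsetD)
  show "d (zs ! i) (zs ! j) = d (zs' ! i) (zs' ! j)" if "i \<in> fv \<phi>" "j \<in> fv \<phi>" for i j
    using dist less that by blast
qed

lemma ev_Cons_eq_of_dist_eq:
  assumes \<phi>: "formula (Suc (length bs)) \<phi>" and len: "length bs' = length bs"
    and M: "z \<in> M" "z' \<in> M" "set bs \<subseteq> M" "set bs' \<subseteq> M"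
    and z: "\<And>i. i < length bs \<Longrightarrow> d z (bs ! i) = d z' (bs' ! i)"
    and b: "\<And>i j. i < length bs \<Longrightarrow> j < length bs \<Longrightarrow> d (bs ! i) (bs ! j) = d (bs' ! i) (bs' ! j)"
  shows "ev M d \<phi> ([z] @ bs) = ev M d \<phi> ([z'] @ bs')"
proof (rule ev_eq_of_dist_eq)
  have z_sym: "d (bs ! i) z = d (bs' ! i) z'" if "i < length bs" for i
    using z[OF that] by (simp only: commute[of _ z] commute[of _ z'])
  fix i j assume "i < length ([z] @ bs)" "j < length ([z] @ bs)"
  then show "d (([z] @ bs) ! i) (([z] @ bs) ! j) = d (([z'] @ bs') ! i) (([z'] @ bs') ! j)"
    using z z_sym b M by (cases i; cases j) simp_all
qed (use \<phi> len M in simp_all)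

lemma tp_singleton_eq:
  assumes "A \<subseteq> M" "z \<in> M" "z' \<in> M" "\<And>c. c \<in> A \<Longrightarrow> d z c = d z' c"
  shows "tp M d [z] A = tp M d [z'] A"
proof -
  have "ev M d \<phi> ([z] @ bs) = ev M d \<phi> ([z'] @ bs)" if "(\<phi>, bs) \<in> formulas_over 1 A" for \<phi> bs
  proof (rule ev_Cons_eq_of_dist_eq)
    show "formula (Suc (length bs)) \<phi>" using that by (simp add: formulas_over_def)
    have bs: "set bs \<subseteq> A" using that by (simp add: formulas_over_def)
    then show "set bs \<subseteq> M" "set bs \<subseteq> M" using assms(1) by blast+
    show "d z (bs ! i) = d z' (bs ! i)" if "i < length bs" for i
      using assms(4) bs nth_mem[OF that] by blast
  qed (use assms in simp_all)
  then show ?thesis by (auto simp: tp_def)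
qed

text \<open>A distance, being a real number, is recorded in the type through a
  \<open>near_fm\<close> condition.\<close>

lemma
  assumes sub: "tp M d zs A \<subseteq> tp M d zs' A" and len: "length zs' = length zs"
    and M: "set zs \<subseteq> M" "A \<subseteq> M"
  shows dist_nth_eq_of_tp: "i < length zs \<Longrightarrow> j < length zs \<Longrightarrow> d (zs' ! i) (zs' ! j) = d (zs ! i) (zs ! j)"
    and dist_param_eq_of_tp: "i < length zs \<Longrightarrow> c \<in> A \<Longrightarrow> d (zs' ! i) c = d (zs ! i) c"
proof -
  have mem: "zs ! i \<in> M" if "i < length zs" for i using that M(1) nth_mem by blast
  show "d (zs' ! i) (zs' ! j) = d (zs ! i) (zs ! j)" if ij: "i < length zs" "j < length zs"
  proof -
    let ?\<phi> = "near_fm (d (zs ! i) (zs ! j)) (Dist i j)"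
    have "wf_fm ?\<phi>" using dist_le_1[OF mem[OF ij(1)] mem[OF ij(2)]] by (intro wf_near_fm) auto
    then have "(?\<phi>, []) \<in> tp M d zs A"
      using ij by (simp add: tp_def formulas_over_def formula_def ev_def)
    then have "(?\<phi>, []) \<in> tp M d zs' A" using sub by blast
    then show ?thesis by (simp add: tp_def ev_def)
  qed
  show "d (zs' ! i) c = d (zs ! i) c" if ic: "i < length zs" "c \<in> A"
  proof -
    \<comment> \<open>The variables of \<open>zs\<close> are numbered below
      \<open>length zs\<close>, so this number is the one replaced by the parameter
      \<open>c\<close>.\<close>
    let ?\<phi> = "near_fm (d (zs ! i) c) (Dist i (length zs))"
    have "c \<in> M" using ic(2) M(2) by blast
    then have "wf_fm ?\<phi>" using dist_le_1[OF mem[OF ic(1)]] by (intro wf_near_fm) auto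
    then have "(?\<phi>, [c]) \<in> tp M d zs A"
      using ic by (simp add: tp_def formulas_over_def formula_def ev_def nth_append)
    then have "(?\<phi>, [c]) \<in> tp M d zs' A" using sub by blast
    then show ?thesis using ic(1) len by (simp add: tp_def ev_def nth_append)
  qed
qed

lemma dist_eq_of_tp_singleton:
  assumes "tp M d [z] A \<subseteq> tp M d [z'] A" "z \<in> M" "A \<subseteq> M" "c \<in> A"
  shows "d z' c = d z c"
  using dist_param_eq_of_tp[of "[z]" A "[z']" 0 c] assms by simp

lemma realizes_tp: "realizes M d zs (tp M d zs A)"
  by (auto simp: realizes_def tp_def)

lemma tp_mono: "A \<subseteq> B \<Longrightarrow> tp M d zs A \<subseteq> tp M d zs B"
  by (auto simp: tp_def formulas_over_def)

lemma consistent_of_realizes: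
  assumes "zs \<in> tuples M n" "realizes M d zs p"
  shows "consistent M d n p"
  unfolding consistent_def
proof (intro allI impI)
  fix F \<epsilon> assume F: "finite F \<and> F \<subseteq> p \<and> 0 < (\<epsilon>::real)"
  have "\<forall>(\<phi>, bs)\<in>F. ev M d \<phi> (zs @ bs) \<le> \<epsilon>"
  proof (intro ballI, clarify)
    fix \<phi> bs assume "(\<phi>, bs) \<in> F"
    then have "ev M d \<phi> (zs @ bs) = 0" using F by (intro realizesD[OF assms(2)]) blast
    then show "ev M d \<phi> (zs @ bs) \<le> \<epsilon>" using F by simp
  qed
  then show "\<exists>xs\<in>tuples M n. \<forall>(\<phi>, bs)\<in>F. ev M d \<phi> (xs @ bs) \<le> \<epsilon>" using assms(1) by blast
qed

text \<open>If a consistent extension contained \<phi> = 0 while \<phi> has value r > 0 at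
  \<open>zs\<close>, it would also contain \<open>near_fm r \<phi>\<close>; with tolerance r/3 the
  two conditions exclude each other.\<close>

lemma tp_complete:
  assumes zs: "zs \<in> tuples M n" and A: "A \<subseteq> M"
  shows "tp M d zs A \<in> complete_types M d n A"
proof -
  have len: "length zs = n" "set zs \<subseteq> M" using zs by (simp_all add: tuples_def)
  have "q = tp M d zs A"
    if q: "q \<subseteq> formulas_over n A" "consistent M d n q" "tp M d zs A \<subseteq> q" for q
  proof (rule antisym)
    show "q \<subseteq> tp M d zs A"
    proof clarify
      fix \<phi> bs assume \<phi>: "(\<phi>, bs) \<in> q"
      then have form: "(\<phi>, bs) \<in> formulas_over n A" using q(1) by blast
      define r where "r = ev M d \<phi> (zs @ bs)"
      have r: "r \<in> {0..1}"
        unfolding r_def using form len A by (intro ev_in_01) (auto simp: formulas_over_def)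
      have "r = 0"
      proof (rule ccontr)
        assume "r \<noteq> 0"
        then have "r > 0" using r by simp
        have "(near_fm r \<phi>, bs) \<in> tp M d zs A"
          using form len r
          by (simp add: tp_def formulas_over_def formula_def wf_near_fm ev_def r_def)
        then have F: "{(\<phi>, bs), (near_fm r \<phi>, bs)} \<subseteq> q" using \<phi> q(3) by blast
        have "r / 3 > 0" using \<open>r > 0\<close> by simp
        then obtain xs where
          "\<forall>(\<psi>, cs)\<in>{(\<phi>, bs), (near_fm r \<phi>, bs)}. ev M d \<psi> (xs @ cs) \<le> r / 3"
          using q(2) F unfolding consistent_def by (metis finite.intros)
        then have "ev M d \<phi> (xs @ bs) \<le> r / 3" "\<bar>ev M d \<phi> (xs @ bs) - r\<bar> \<le> r / 3"
          by (simp_all add: ev_def)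
        then show False using \<open>r > 0\<close> by linarith
      qed
      then show "(\<phi>, bs) \<in> tp M d zs A"
        using form len by (simp add: tp_def r_def)
    qed
  qed (fact q(3))
  moreover have "tp M d zs A \<subseteq> formulas_over n A" using len by (auto simp: tp_def)
  ultimately show ?thesis
    using consistent_of_realizes[OF zs realizes_tp] by (simp add: complete_types_def)
qed

text \<open>Saturation realizes the type, and maximality makes it the whole type of the
  realization.\<close>

lemma complete_type_eq_tp:
  assumes "p \<in> complete_types M d n A" "A \<subseteq> M" "|A| <o \<kappa>"
  obtains zs where "zs \<in> tuples M n" "p = tp M d zs A"
proof -
  have p: "p \<subseteq> formulas_over n A" "consistent M d n p"
    and max: "\<And>q. q \<subseteq> formulas_over n A \<Longrightarrow> consistent M d n q \<Longrightarrow> p \<subseteq> q \<Longrightarrow> q = p"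
    using assms(1) unfolding complete_types_def by simp_all
  obtain zs where zs: "zs \<in> tuples M n" "realizes M d zs p"
    using realized_of_consistent[OF assms(2,3) p] .
  have len: "length zs = n" using zs(1) by (simp add: tuples_def)
  have "p \<subseteq> tp M d zs A"
  proof
    fix q assume "q \<in> p"
    moreover obtain \<phi> bs where "q = (\<phi>, bs)" by (cases q)
    ultimately show "q \<in> tp M d zs A"
      using realizesD[OF zs(2)] p(1) len by (auto simp: tp_def)
  qed
  moreover have "tp M d zs A \<subseteq> formulas_over n A" using len by (auto simp: tp_def)
  ultimately have "tp M d zs A = p"
    using max consistent_of_realizes[OF zs(1) realizes_tp] by blast
  then show thesis using that zs(1) by blast
qed

lemma complete_type_singleton:
  assumes "p \<in> complete_types M d 1 A" "A \<subseteq> M" "|A| <o \<kappa>"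
  obtains z where "z \<in> M" "p = tp M d [z] A"
proof -
  obtain zs where "zs \<in> tuples M 1" "p = tp M d zs A"
    using complete_type_eq_tp[OF assms] .
  moreover from this obtain z where "zs = [z]" "z \<in> M" by (auto simp: tuples_def length_Suc_conv)
  ultimately show thesis using that by blast
qed

lemma singleton_in_tuples: "[z] \<in> tuples M 1 \<longleftrightarrow> z \<in> M"
  by (simp add: tuples_def)

section \<open>Nonforking extensions\<close>

context
  fixes C a b r
  assumes C: "C \<subseteq> M" and a: "a \<in> M" and b: "b \<in> M"
    and r_ge: "d_min d a b C \<le> r" and r_le: "r \<le> d_max d a b C" and r_half: "d_max d b b C \<le> 2 * r"
begin

text \<open>A point realizing \<open>free_ext\<close> on the conjugates of \<open>cs\<close> lies in
  the same position to each of them as \<open>z\<close> to \<open>cs\<close>, so \<psi> vanishes at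
  all of them.\<close>

lemma free_ext_not_divides:
  assumes \<psi>: "(\<psi>, cs) \<in> formulas_over 1 M" and z: "z \<in> M" "ev M d \<psi> ([z] @ cs) = 0"
    and free: "\<And>y. y \<in> set cs \<Longrightarrow> d z y = free_ext C a b r y"
  shows "\<not> divides M d C 1 \<psi> cs"
proof
  assume "divides M d C 1 \<psi> cs"
  then obtain B :: "nat \<Rightarrow> 'a list" and \<epsilon> k where B: "\<forall>l. B l \<in> tuples M (length cs) \<and> tp M d (B l) C = tp M d cs C"
    and \<epsilon>: "\<epsilon> > 0"
    and unsat: "\<forall>I. finite I \<and> card I = k \<longrightarrow>
      \<not> (\<exists>xs\<in>tuples M 1. \<forall>l\<in>I. max (ev M d \<psi> (xs @ B l) - \<epsilon>) 0 = 0)"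
    unfolding divides_def by (elim exE conjE) (rule that, assumption+)
  \<comment> \<open>Satisfying the first \<open>k\<close> conditions already contradicts
    inconsistency of all \<open>k\<close>-element subsets, and it involves only finitely many
    points.\<close>
  let ?A = "\<Union>l<k. set (B l)"
  have form: "formula (Suc (length cs)) \<psi>" and cs: "set cs \<subseteq> M"
    using \<psi> by (simp_all add: formulas_over_def)
  have len: "length (B l) = length cs" and BM: "set (B l) \<subseteq> M" for l
    using B by (simp_all add: tuples_def)
  have AM: "?A \<subseteq> M" using BM by blast
  have "finite ?A" by simp
  then obtain x where x: "x \<in> M" "\<And>y. y \<in> ?A \<Longrightarrow> d x y = free_ext C a b r y"
    using one_point_extension[OF AM finite_small
        katetov_subset[OF katetov_free_ext[OF C a b r_ge r_le r_half] AM]] by blast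
  have "ev M d \<psi> ([x] @ B l) = 0" if "l < k" for l
  proof -
    have tp_eq: "tp M d cs C \<subseteq> tp M d (B l) C" using B by simp
    have "ev M d \<psi> ([x] @ B l) = ev M d \<psi> ([z] @ cs)"
    proof (rule ev_Cons_eq_of_dist_eq)
      fix i assume i: "i < length (B l)"
      then have i': "i < length cs" by (simp add: len)
      have "d (B l ! i) c = d (cs ! i) c" if "c \<in> C" for c
        by (rule dist_param_eq_of_tp[OF tp_eq len cs C i' that])
      then have "free_ext C a b r (B l ! i) = free_ext C a b r (cs ! i)"
        by (rule free_ext_cong[OF C])
      moreover have "B l ! i \<in> ?A" using \<open>l < k\<close> nth_mem[OF i] by blast
      ultimately show "d x (B l ! i) = d z (cs ! i)"
        using x(2) free nth_mem[OF i'] by simp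
    next
      fix i j assume "i < length (B l)" "j < length (B l)"
      then show "d (B l ! i) (B l ! j) = d (cs ! i) (cs ! j)"
        using dist_nth_eq_of_tp[OF tp_eq len cs C] by (simp add: len)
    qed (use form len BM cs x(1) z(1) in simp_all)
    then show ?thesis using z(2) by simp
  qed
  then have "\<forall>l\<in>{..<k}. max (ev M d \<psi> ([x] @ B l) - \<epsilon>) 0 = 0" using \<epsilon> by simp
  moreover have "\<not> (\<exists>xs\<in>tuples M 1. \<forall>l\<in>{..<k}. max (ev M d \<psi> (xs @ B l) - \<epsilon>) 0 = 0)"
    using unsat[THEN spec, of "{..<k}"] by simp
  ultimately show False using singleton_in_tuples x(1) by blast
qed

text \<open>The point \<open>z\<close> realizes \<open>free_ext\<close> on
  \<open>insert b C\<close>, and the same type has realizations following \<open>free_ext\<close> on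
  any further finite set.\<close>

lemma nonforking_extension:
  assumes "|C| <o \<kappa>"
  obtains z where "z \<in> M" "\<And>c. c \<in> C \<Longrightarrow> d z c = d a c" "d z b = r"
    "\<not> type_forks M d C 1 (tp M d [z] (insert b C))"
proof -
  let ?g = "free_ext C a b r"
  have realize: "\<exists>z\<in>M. \<forall>y\<in>insert b C \<union> P. d z y = ?g y" if P: "finite P" "P \<subseteq> M" for P
  proof -
    have "|{b} \<union> (C \<union> P)| <o \<kappa>" 
      using small_Un[OF finite_small[of "{b}"] small_Un[OF assms finite_small[OF P(1)]]] by simp
    then have small: "|insert b C \<union> P| <o \<kappa>" by simp
    have sub: "insert b C \<union> P \<subseteq> M" using C b P(2) by blast
    obtain z where "z \<in> M" "\<And>y. y \<in> insert b C \<union> P \<Longrightarrow> d z y = ?g y"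
      using one_point_extension[OF sub small
          katetov_subset[OF katetov_free_ext[OF C a b r_ge r_le r_half] sub]] by blast
    then show ?thesis by blast
  qed
  from realize[of "{}"] obtain z where z: "z \<in> M" "\<And>y. y \<in> insert b C \<Longrightarrow> d z y = ?g y"
    by auto
  have "\<not> type_forks M d C 1 (tp M d [z] (insert b C))"
  proof
    assume "type_forks M d C 1 (tp M d [z] (insert b C))"
    then obtain \<phi> bs where \<phi>: "forks M d C 1 \<phi> bs"
      "\<And>xs. xs \<in> tuples M 1 \<Longrightarrow> realizes M d xs (tp M d [z] (insert b C)) \<Longrightarrow> ev M d \<phi> (xs @ bs) = 0"
      unfolding type_forks_def by blast
    then obtain \<Psi> :: "(fm \<times> 'a list) set" where \<Psi>: "finite \<Psi>" "\<Psi> \<noteq> {}" "\<Psi> \<subseteq> formulas_over 1 M"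
      "\<forall>(\<psi>, cs)\<in>\<Psi>. divides M d C 1 \<psi> cs"
      "\<forall>xs\<in>tuples M 1. ev M d \<phi> (xs @ bs) = 0 \<longrightarrow> Min ((\<lambda>(\<psi>, cs). ev M d \<psi> (xs @ cs)) ` \<Psi>) = 0"
      unfolding forks_def by (elim exE conjE) (rule that, assumption+)
    \<comment> \<open>The distances from \<open>z\<close> to these parameters are uncontrolled. A
      second realization \<open>z'\<close> of the same type, following \<open>free_ext\<close> on
      them too, satisfies some member of \<Psi>, which then cannot divide.\<close>
    let ?P = "\<Union>(\<psi>, cs)\<in>\<Psi>. set cs"
    have "finite ?P" using \<Psi>(1) by auto
    moreover have "?P \<subseteq> M" using \<Psi>(3) by (auto simp: formulas_over_def)
    ultimately obtain z' where z': "z' \<in> M" "\<And>y. y \<in> insert b C \<union> ?P \<Longrightarrow> d z' y = ?g y"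
      using realize by meson
    have "tp M d [z'] (insert b C) = tp M d [z] (insert b C)"
      using C b z z' by (intro tp_singleton_eq) auto
    then have "realizes M d [z'] (tp M d [z] (insert b C))" using realizes_tp by metis
    then have "ev M d \<phi> ([z'] @ bs) = 0" using \<phi>(2) z'(1) singleton_in_tuples by blast
    then have "Min ((\<lambda>(\<psi>, cs). ev M d \<psi> ([z'] @ cs)) ` \<Psi>) = 0"
      using \<Psi>(5) z'(1) singleton_in_tuples by blast
    then have "0 \<in> (\<lambda>(\<psi>, cs). ev M d \<psi> ([z'] @ cs)) ` \<Psi>"
      using Min_in[of "(\<lambda>(\<psi>, cs). ev M d \<psi> ([z'] @ cs)) ` \<Psi>"] \<Psi>(1,2) by simp
    then obtain \<psi> cs where \<psi>: "(\<psi>, cs) \<in> \<Psi>" "ev M d \<psi> ([z'] @ cs) = 0" by fastforce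
    have "\<not> divides M d C 1 \<psi> cs"
      using \<psi> \<Psi>(3) z' by (intro free_ext_not_divides[of \<psi> cs z']) blast+
    then show False using \<psi>(1) \<Psi>(4) by blast
  qed
  moreover have "d z c = d a c" if "c \<in> C" for c
    using z(2)[of c] free_ext_on[OF C a b r_ge r_le r_half that] that by simp
  moreover have "d z b = r" using z(2)[of b] free_ext_base[OF C a b r_ge r_le r_half] by simp
  ultimately show thesis using that z(1) by blast
qed

end

end

section \<open>Equivalence of the three conditions\<close>

lemma (in bounded_metric) d_min_le_d_max:
  assumes "C \<subseteq> M" "a \<in> M" "b \<in> M"
  shows "d_min d a b C \<le> d a b" "d a b \<le> d_max d a b C"
  using d_min_le_dist[OF assms] dist_le_d_max[OF assms] by simp_all

theorem theorem3p29:
  fixes U :: "'u set" and e :: "'u \<Rightarrow> 'u \<Rightarrow> real"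
    and M :: "'a set" and d :: "'a \<Rightarrow> 'a \<Rightarrow> real"
    and \<kappa> :: "'k rel" and C :: "'a set" and a b :: 'a
  assumes "urysohn_sphere U e"
    and "monster_model \<kappa> M d (Th U e)"
    and "C \<subseteq> M" and "|C| <o \<kappa>"
    and "a \<in> M" and "b \<in> M"
  shows "((\<exists>!p. p \<in> complete_types M d 1 (insert b C) \<and> tp M d [a] C \<subseteq> p \<and>
              \<not> type_forks M d C 1 p) \<longleftrightarrow>
          (\<exists>!p. p \<in> complete_types M d 1 (insert b C) \<and> tp M d [a] C \<subseteq> p))
       \<and> ((\<exists>!p. p \<in> complete_types M d 1 (insert b C) \<and> tp M d [a] C \<subseteq> p) \<longleftrightarrow>
          d_max d a b C = sup01 ((\<lambda>c. \<bar>d a c - d b c\<bar>) ` C))"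
proof -
  have model: "model M d (Th U e)" using assms(2) by (simp add: monster_model_def)
  interpret Metric_space M d using model by (simp add: model_def)
  interpret urysohn_monster M d \<kappa> U e
    using model assms(1,2) by unfold_locales (auto simp: model_def)
  note C = \<open>C \<subseteq> M\<close> and a = \<open>a \<in> M\<close> and b = \<open>b \<in> M\<close>
  let ?A = "insert b C"
  define E where "E p \<longleftrightarrow> p \<in> complete_types M d 1 ?A \<and> tp M d [a] C \<subseteq> p" for p
  define NF where "NF p \<longleftrightarrow> \<not> type_forks M d C 1 p" for p
  have A: "?A \<subseteq> M" using C b by simp
  have small: "|?A| <o \<kappa>"
    using small_Un[OF finite_small[of "{b}"] assms(4)] by simp
  have E_tp: "E (tp M d [z] ?A)" if "z \<in> M" "\<And>c. c \<in> C \<Longrightarrow> d z c = d a c" for z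
  proof -
    have "tp M d [a] C = tp M d [z] C" using that by (intro tp_singleton_eq[OF C a]) simp_all
    also have "\<dots> \<subseteq> tp M d [z] ?A" by (rule tp_mono) blast
    finally show ?thesis
      using tp_complete[OF _ A] that(1) singleton_in_tuples by (simp add: E_def)
  qed
  \<comment> \<open>The last clause states that \<open>p\<close> determines the distance
    \<open>r\<close>; it serves to tell extensions with different \<open>r\<close> apart.\<close>
  have ext: "\<exists>p. E p \<and> NF p \<and> (\<forall>z\<in>M. p = tp M d [z] ?A \<longrightarrow> d z b = r)"
    if r: "d_min d a b C \<le> r" "r \<le> d_max d a b C" "d_max d b b C \<le> 2 * r" for r
  proof -
    obtain z where z: "z \<in> M" "\<And>c. c \<in> C \<Longrightarrow> d z c = d a c" "d z b = r"
      "\<not> type_forks M d C 1 (tp M d [z] ?A)"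
      using nonforking_extension[OF C a b r assms(4)] by blast
    have "d z' b = r" if "z' \<in> M" "tp M d [z] ?A = tp M d [z'] ?A" for z'
      using dist_eq_of_tp_singleton[of z ?A z' b] that z(1,3) A by simp
    then show ?thesis using E_tp[OF z(1,2)] z(4) unfolding NF_def by blast
  qed
  have E_obtain: "\<exists>z\<in>M. p = tp M d [z] ?A \<and> (\<forall>c\<in>C. d z c = d a c)" if p: "E p" for p
  proof -
    obtain z where z: "z \<in> M" "p = tp M d [z] ?A"
      using complete_type_singleton[OF _ A small] p unfolding E_def by blast
    have "d z c = d a c" if "c \<in> C" for c
    proof -
      let ?\<phi> = "near_fm (d a c) (Dist 0 1)"
      have "c \<in> M" using that C by blast
      then have "wf_fm ?\<phi>" using dist_le_1[OF a] by (intro wf_near_fm) auto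
      then have "(?\<phi>, [c]) \<in> tp M d [a] C"
        using that by (simp add: tp_def formulas_over_def formula_def ev_def)
      then have "(?\<phi>, [c]) \<in> tp M d [z] ?A" using p z(2) unfolding E_def by blast
      then show ?thesis by (simp add: tp_def ev_def)
    qed
    then show ?thesis using z by blast
  qed
  have le: "d_min d a b C \<le> d_max d a b C"
    using d_min_le_d_max[OF C a b] by linarith
  \<comment> \<open>Hence the upper end of the interval is always an admissible
    \<open>r\<close>.\<close>
  have half: "d_max d b b C \<le> 2 * d_max d a b C"
    using d_max_le_add[OF C a b b] by simp
  have unique: "\<exists>!p. E p" if eq: "d_max d a b C = d_min d a b C"
  proof (rule ex1I)
    show "E (tp M d [a] ?A)" using a by (intro E_tp) simp_all
    fix p assume "E p"
    then obtain z where z: "z \<in> M" "p = tp M d [z] ?A" "\<forall>c\<in>C. d z c = d a c"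
      using E_obtain by blast
    have "d_min d z b C = d_min d a b C" "d_max d z b C = d_max d a b C"
      using z(3) d_min_cong[of C z a b] d_max_cong[of C z a b]
      by (simp_all add: d_min_def d_max_def)
    \<comment> \<open>Both distances lie between bounds that coincide.\<close>
    then have "d z b = d a b"
      using d_min_le_d_max[OF C z(1) b] d_min_le_d_max[OF C a b] eq by linarith
    then show "p = tp M d [a] ?A"
      unfolding z(2) using z(1,3) by (intro tp_singleton_eq[OF A _ a]) auto
  qed
  have two: "\<exists>p q. E p \<and> NF p \<and> E q \<and> NF q \<and> p \<noteq> q" if ne: "d_max d a b C \<noteq> d_min d a b C"
  proof -
    \<comment> \<open>This is the least value meeting both lower constraints of \<open>ext\<close>;
      by \<open>d_max_half_lt\<close> it stays strictly below the upper end.\<close>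
    define r where "r = max (d_min d a b C) (d_max d b b C / 2)"
    have lt: "d_min d a b C < d_max d a b C" using le ne by simp
    have r: "d_min d a b C \<le> r" "r < d_max d a b C" "d_max d b b C \<le> 2 * r"
      using lt d_max_half_lt[OF C a b lt] by (auto simp: r_def)
    obtain p where p: "E p" "NF p" "\<forall>z\<in>M. p = tp M d [z] ?A \<longrightarrow> d z b = d_max d a b C"
      using ext[OF le order_refl half] by blast
    obtain q where q: "E q" "NF q" "\<forall>z\<in>M. q = tp M d [z] ?A \<longrightarrow> d z b = r"
      using ext[OF r(1) less_imp_le[OF r(2)] r(3)] by blast
    have "p \<noteq> q" using E_obtain[OF p(1)] p(3) q(3) r(2) by force
    then show ?thesis using p q by blast
  qed
  \<comment> \<open>Existence of \<open>p0\<close> makes a unique extension also the unique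
    nonforking one; if the bounds differ, \<open>two\<close> refutes both kinds of
    uniqueness.\<close>
  obtain p0 where "E p0" "NF p0" using ext[OF le order_refl half] by blast
  then have "((\<exists>!p. E p \<and> NF p) \<longleftrightarrow> (\<exists>!p. E p)) \<and> ((\<exists>!p. E p) \<longleftrightarrow> d_max d a b C = d_min d a b C)"
    using unique two by metis
  then show ?thesis by (simp only: E_def NF_def d_min_def conj_assoc)
qed

end
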